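(* Let $X$ be a set. The category $\mathbb X$ of all subsets of $X$ with partial bijections as morphisms is normal and bounded above. The semigroup $\widehat{\mathbb X}$ of cones in $\mathbb X$ is isomorphic to the symmetric inverse monoid $\mathscr I_X$. The normal category $\mathbb L(\mathscr I_X)$ and the category $\mathbb X$ are isomorphic as self-supported categories.
   Context: Conventions. Mappings, morphisms and functors are composed from left to right ($fg$ means first $f$, then $g$). For a category $\mathcal C$, $v\mathcal C$ denotes its class of objects and $\mathcal C(c,c')$ the set of morphisms from $c$ to $c'$. A monomorphism is a right cancellable morphism and an epimorphism is a left cancellable morphism. A semigroup $S$ is regular if for every $a\in S$ there is $x\in S$ with $axa=a$; $E(S)$ is its set of idempotents. Normal categories. A strict preorder is a category with at most one morphism between any two (possibly equal) objects in which the only isomorphisms are identities. A category with subobjects is a small category $\mathcal C$ with a subcategory $\mathcal P$ such that: $\mathcal P$ is a strict preorder with $v\mathcal P=v\mathcal C$; every $f\in\mathcal P$ is a monomorphism in $\mathcal C$; if $f,g\in\mathcal P$ and $f=hg$ with $h\in\mathcal C$, then $h\in\mathcal P$. Morphisms of $\mathcal P$ are called inclusions; $c\preceq c'$ means $\mathcal P(c,c')\neq\emptyset$, and $j(c,c')$ is then the unique inclusion. An inclusion $j\colon c\to c'$ splits if there is $q\colon c'\to c$ in $\mathcal C$ with $jq=1_c$; such a $q$ is called a retraction. A normal factorisation of a morphism $f$ is $f=quj$ with $q$ a retraction, $u$ an isomorphism, $j$ an inclusion. A cone with vertex $z\in v\mathcal C$ is a map $\gamma$ assigning to each $c\in v\mathcal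 C$ a morphism $\gamma(c)\in\mathcal C(c,z)$ such that $j(a,b)\gamma(b)=\gamma(a)$ whenever $a\preceq b$, and $\gamma(c)$ is an isomorphism for at least one $c$; the vertex is denoted $z_\gamma$. $\mathcal C$ is a normal category if it is a category with subobjects in which every inclusion splits, every morphism has a normal factorisation, and for each $c\in v\mathcal C$ there is a cone $\mu$ with vertex $c$ and $\mu(c)=1_c$. In a normal category, for a normal factorisation $f=quj$ the epimorphism $f^\circ:=qu$ does not depend on the factorisation. A normal category $\mathcal C$ is bounded above if there is $d\in v\mathcal C$ with $c\preceq d$ for every $c\in v\mathcal C$. Semigroup of cones. For a cone $\gamma$ and an epimorphism $f$ with domain $z_\gamma$, $\gamma\ast f$ is the cone $c\mapsto\gamma(c)f$. The set $\widehat{\mathcal C}$ of all cones in a normal category $\mathcal C$ is a regular semigroup under $\gamma\cdot\delta=\gamma\ast(\delta(z_\gamma))^\circ$. Let $\mathscr R$ be Green's relation on $\widehat{\mathcal C}$, $R_\gamma$ the $\mathscr R$-class of $\gamma$; $\widehat{\mathcal C}/\mathscr R$ is partially ordered by $R_\gamma\sqsubseteq R_\delta$ iff the principal right ideal generated by $\gamma$ is contained in that generated by $\delta$. Connected and self-supported categories. Let $\mathcal C$ be a normal category and $\mathfrak D$ a down-set of $(\widehat{\mathcal C}/\mathscr R,\sqsubseteq)$. An object $c$ is connected by (or to) $\mathfrak d\in\mathfrak D$ if $\mathfrak d$ contains an idempotent cone with vertex $c$; this cone is then unique and is denoted $\epsilon(c,\mathfrak d)$. $\mathcal C$ is connected by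 $\mathfrak D$ if every $c\in v\mathcal C$ is connected by some $\mathfrak d\in\mathfrak D$; then the pair is denoted $\mathcal C_{\mathfrak D}$ and called a connected category. It is supported if each $c$ is connected by a unique $\mathfrak d\in\mathfrak D$, and self-supported if moreover the support map $v\mathcal C\to\mathfrak D$, sending $c$ to the unique $\mathfrak d$ connecting it, is an order isomorphism from $(v\mathcal C,\preceq)$ to $(\mathfrak D,\sqsubseteq)$. A CC-morphism from $\mathcal C_{\mathfrak D}$ to $\mathcal C'_{\mathfrak D'}$ is a pair $(F,G)$ where $F\colon\mathcal C\to\mathcal C'$ is an inclusion preserving functor and $G\colon\mathfrak D\to\mathfrak D'$ is an order preserving map such that whenever $c$ is connected to $\mathfrak d$, $F(c)$ is connected to $G(\mathfrak d)$ and $F(\epsilon(c,\mathfrak d)(c'))=\epsilon(F(c),G(\mathfrak d))(F(c'))$ for every $c'\in v\mathcal C$. A normal category $\mathcal C$ is treated as a connected category with $\mathfrak D=\widehat{\mathcal C}/\mathscr R$. "Isomorphic as self-supported categories" means: both are self-supported and they are isomorphic via CC-morphisms. The categories involved. For a regular semigroup $S$, $\mathbb L(S)$ is the category whose objects are the principal left ideals $Se$ ($e\in E(S)$) and whose morphisms from $Se$ to $Sf$ are the mappings $r(e,u,f)\colon Se\to Sf$, $x\mapsto xu$, for $u\in eSf$, composed as maps; its inclusions are the morphisms $r(e,e,f)$ for $Se\subseteq Sf$; it is a normal category. $\mathscr I_X$ is the monoid of all partial bijections of $X$ (bijections between subsets of $X$) under composition of partial maps. $\mathbb X$ has as objects all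 subsets of $X$ and as morphisms from $A$ to $B$ all partial bijections from $A$ to $B$ (injective partial maps, with domain contained in $A$ and image contained in $B$), under composition of partial maps; its inclusions are the set inclusion maps $A\to B$ for $A\subseteq B$. *)

theory Defs
  imports "HOL-Algebra.Group"
begin

section \<open>Categories\<close>

text \<open>
  Composition is written from left to right: \<open>f \<cdot>\<^bsub>C\<^esub> g\<close> is \<open>f\<close> followed by \<open>g\<close>.  Every morphism
  determines its domain and codomain; \<open>Comp\<close> is meaningful only for composable pairs, so
  composability is stated explicitly wherever products of morphisms occur.
\<close>

record ('o, 'm) category =
  Obj :: "'o set"
  Arr :: "'m set"
  Dom :: "'m \<Rightarrow> 'o"
  Cod :: "'m \<Rightarrow> 'o"
  Ide :: "'o \<Rightarrow> 'm"
  Comp :: "'m \<Rightarrow> 'm \<Rightarrow> 'm" (infixl "\<cdot>\<index>" 70)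

definition Mor :: "('o, 'm, 'x) category_scheme \<Rightarrow> 'o \<Rightarrow> 'o \<Rightarrow> 'm set" where
  "Mor C a b = {f \<in> Arr C. Dom C f = a \<and> Cod C f = b}"

locale category =
  fixes C :: "('o, 'm, 'x) category_scheme" (structure)
  assumes Dom_closed: "f \<in> Arr C \<Longrightarrow> Dom C f \<in> Obj C"
    and Cod_closed: "f \<in> Arr C \<Longrightarrow> Cod C f \<in> Obj C"
    and Ide_closed: "a \<in> Obj C \<Longrightarrow> Ide C a \<in> Mor C a a"
    and Comp_closed: "f \<in> Mor C a b \<Longrightarrow> g \<in> Mor C b c \<Longrightarrow> f \<cdot> g \<in> Mor C a c"
    and Ide_left: "f \<in> Mor C a b \<Longrightarrow> Ide C a \<cdot> f = f"
    and Ide_right: "f \<in> Mor C a b \<Longrightarrow> f \<cdot> Ide C b = f"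
    and Comp_assoc: "f \<in> Mor C a b \<Longrightarrow> g \<in> Mor C b c \<Longrightarrow> h \<in> Mor C c d \<Longrightarrow>
      f \<cdot> g \<cdot> h = f \<cdot> (g \<cdot> h)"

definition isomorphism :: "('o, 'm, 'x) category_scheme \<Rightarrow> 'm \<Rightarrow> bool" where
  "isomorphism C f \<longleftrightarrow> f \<in> Arr C \<and>
     (\<exists>g \<in> Mor C (Cod C f) (Dom C f).
        f \<cdot>\<^bsub>C\<^esub> g = Ide C (Dom C f) \<and> g \<cdot>\<^bsub>C\<^esub> f = Ide C (Cod C f))"

definition monomorphism :: "('o, 'm, 'x) category_scheme \<Rightarrow> 'm \<Rightarrow> bool" where
  "monomorphism C f \<longleftrightarrow> f \<in> Arr C \<and>
     (\<forall>a. \<forall>g \<in> Mor C a (Dom C f). \<forall>h \<in> Mor C a (Dom C f). g \<cdot>\<^bsub>C\<^esub> f = h \<cdot>\<^bsub>C\<^esub> f \<longrightarrow> g = h)"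

locale strict_preorder = category +
  assumes at_most_one: "f \<in> Mor C a b \<Longrightarrow> g \<in> Mor C a b \<Longrightarrow> f = g"
    and iso_is_identity: "isomorphism C f \<Longrightarrow> f = Ide C (Dom C f)"

section \<open>Normal categories\<close>

record ('o, 'm) subobject_category = "('o, 'm) category" +
  Incl :: "'m set"

definition inclusions :: "('o, 'm, 'x) subobject_category_scheme \<Rightarrow> ('o, 'm) category" where
  "inclusions C = \<lparr>Obj = Obj C, Arr = Incl C, Dom = Dom C, Cod = Cod C, Ide = Ide C, Comp = Comp C\<rparr>"

locale category_with_subobjects =
  category C for C :: "('o, 'm, 'x) subobject_category_scheme" (structure) +
  assumes Incl_subset: "Incl C \<subseteq> Arr C"
    and strict_preorder_inclusions: "strict_preorder (inclusions C)"
    and inclusion_mono: "f \<in> Incl C \<Longrightarrow> monomorphism C f"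
    and inclusion_factor: "f \<in> Incl C \<Longrightarrow> g \<in> Incl C \<Longrightarrow> h \<in> Arr C \<Longrightarrow> Cod C h = Dom C g \<Longrightarrow>
      f = h \<cdot> g \<Longrightarrow> h \<in> Incl C"

definition subobject :: "('o, 'm, 'x) subobject_category_scheme \<Rightarrow> 'o \<Rightarrow> 'o \<Rightarrow> bool" where
  "subobject C c c' \<longleftrightarrow> Mor (inclusions C) c c' \<noteq> {}"

definition inclusion :: "('o, 'm, 'x) subobject_category_scheme \<Rightarrow> 'o \<Rightarrow> 'o \<Rightarrow> 'm" where
  "inclusion C c c' = (THE j. j \<in> Mor (inclusions C) c c')"

definition retraction_of :: "('o, 'm, 'x) subobject_category_scheme \<Rightarrow> 'm \<Rightarrow> 'm \<Rightarrow> bool" where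
  "retraction_of C j q \<longleftrightarrow> j \<in> Incl C \<and> q \<in> Mor C (Cod C j) (Dom C j) \<and>
     j \<cdot>\<^bsub>C\<^esub> q = Ide C (Dom C j)"

definition retraction :: "('o, 'm, 'x) subobject_category_scheme \<Rightarrow> 'm \<Rightarrow> bool" where
  "retraction C q \<longleftrightarrow> (\<exists>j. retraction_of C j q)"

definition normal_factorisation ::
  "('o, 'm, 'x) subobject_category_scheme \<Rightarrow> 'm \<Rightarrow> 'm \<Rightarrow> 'm \<Rightarrow> 'm \<Rightarrow> bool" where
  "normal_factorisation C f q u j \<longleftrightarrow>
     retraction C q \<and> isomorphism C u \<and> j \<in> Incl C \<and>
     Cod C q = Dom C u \<and> Cod C u = Dom C j \<and> f = q \<cdot>\<^bsub>C\<^esub> u \<cdot>\<^bsub>C\<^esub> j"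

text \<open>
  Cones are extensional functions on the objects (\<open>undefined\<close> elsewhere), so that equality of
  cones as maps on \<open>Obj C\<close> is equality in HOL.
\<close>

definition cone_with_vertex ::
  "('o, 'm, 'x) subobject_category_scheme \<Rightarrow> 'o \<Rightarrow> ('o \<Rightarrow> 'm) \<Rightarrow> bool" where
  "cone_with_vertex C z \<gamma> \<longleftrightarrow>
     z \<in> Obj C \<and> \<gamma> \<in> (\<Pi>\<^sub>E c \<in> Obj C. Mor C c z) \<and>
     (\<forall>a \<in> Obj C. \<forall>b \<in> Obj C. subobject C a b \<longrightarrow> inclusion C a b \<cdot>\<^bsub>C\<^esub> \<gamma> b = \<gamma> a) \<and>
     (\<exists>c \<in> Obj C. isomorphism C (\<gamma> c))"

definition cones :: "('o, 'm, 'x) subobject_category_scheme \<Rightarrow> ('o \<Rightarrow> 'm) set" where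
  "cones C = {\<gamma>. \<exists>z. cone_with_vertex C z \<gamma>}"

definition vertex :: "('o, 'm, 'x) subobject_category_scheme \<Rightarrow> ('o \<Rightarrow> 'm) \<Rightarrow> 'o" where
  "vertex C \<gamma> = (THE z. cone_with_vertex C z \<gamma>)"

locale normal_category = category_with_subobjects +
  assumes inclusion_splits: "j \<in> Incl C \<Longrightarrow> \<exists>q. retraction_of C j q"
    and has_normal_factorisation: "f \<in> Arr C \<Longrightarrow> \<exists>q u j. normal_factorisation C f q u j"
    and has_cone: "c \<in> Obj C \<Longrightarrow> \<exists>\<mu>. cone_with_vertex C c \<mu> \<and> \<mu> c = Ide C c"

definition bounded_above :: "('o, 'm, 'x) subobject_category_scheme \<Rightarrow> bool" where
  "bounded_above C \<longleftrightarrow> (\<exists>d \<in> Obj C. \<forall>c \<in> Obj C. subobject C c d)"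

section \<open>The semigroup of cones\<close>

text \<open>
  Written $f^\circ$ in the literature; in a normal category the product \<open>q \<cdot> u\<close> is the same for all
  normal factorisations of \<open>f\<close>.
\<close>

definition epi_part :: "('o, 'm, 'x) subobject_category_scheme \<Rightarrow> 'm \<Rightarrow> 'm" where
  "epi_part C f = (THE e. \<exists>q u j. normal_factorisation C f q u j \<and> e = q \<cdot>\<^bsub>C\<^esub> u)"

definition cone_star ::
  "('o, 'm, 'x) subobject_category_scheme \<Rightarrow> ('o \<Rightarrow> 'm) \<Rightarrow> 'm \<Rightarrow> ('o \<Rightarrow> 'm)" where
  "cone_star C \<gamma> f = (\<lambda>c \<in> Obj C. \<gamma> c \<cdot>\<^bsub>C\<^esub> f)"

text \<open>
  Semigroups are represented by the records of \<^theory>\<open>HOL-Algebra.Group\<close>; nothing below refers to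
  the field \<open>one\<close>.  In particular \<open>hom\<close>, \<open>iso\<close> and \<open>\<cong>\<close> use only the carrier and the multiplication.
  The semigroup of cones need not have a unit, so its field \<open>one\<close> is left unspecified.
\<close>

definition cone_semigroup :: "('o, 'm, 'x) subobject_category_scheme \<Rightarrow> ('o \<Rightarrow> 'm) monoid" where
  "cone_semigroup C =
     \<lparr>carrier = cones C,
      mult = (\<lambda>\<gamma> \<delta>. cone_star C \<gamma> (epi_part C (\<delta> (vertex C \<gamma>)))),
      one = undefined\<rparr>"

definition idempotents :: "('a, 'x) monoid_scheme \<Rightarrow> 'a set" where
  "idempotents S = {e \<in> carrier S. e \<otimes>\<^bsub>S\<^esub> e = e}"

definition principal_right_ideal :: "('a, 'x) monoid_scheme \<Rightarrow> 'a \<Rightarrow> 'a set" where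
  "principal_right_ideal S a = insert a {a \<otimes>\<^bsub>S\<^esub> s | s. s \<in> carrier S}"

definition green_R :: "('a, 'x) monoid_scheme \<Rightarrow> ('a \<times> 'a) set" where
  "green_R S = {(a, b). a \<in> carrier S \<and> b \<in> carrier S \<and>
     principal_right_ideal S a = principal_right_ideal S b}"

definition R_classes :: "('a, 'x) monoid_scheme \<Rightarrow> 'a set set" where
  "R_classes S = carrier S // green_R S"

definition R_le :: "('a, 'x) monoid_scheme \<Rightarrow> 'a set \<Rightarrow> 'a set \<Rightarrow> bool" where
  "R_le S r r' \<longleftrightarrow>
     (\<exists>a \<in> r. \<exists>b \<in> r'. principal_right_ideal S a \<subseteq> principal_right_ideal S b)"

section \<open>Connected and self-supported categories\<close>

definition down_set :: "('o, 'm, 'x) subobject_category_scheme \<Rightarrow> ('o \<Rightarrow> 'm) set set \<Rightarrow> bool" where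
  "down_set C D \<longleftrightarrow> D \<subseteq> R_classes (cone_semigroup C) \<and>
     (\<forall>d \<in> D. \<forall>d' \<in> R_classes (cone_semigroup C). R_le (cone_semigroup C) d' d \<longrightarrow> d' \<in> D)"

definition connected_by ::
  "('o, 'm, 'x) subobject_category_scheme \<Rightarrow> 'o \<Rightarrow> ('o \<Rightarrow> 'm) set \<Rightarrow> bool" where
  "connected_by C c d \<longleftrightarrow> (\<exists>\<epsilon> \<in> d. \<epsilon> \<in> idempotents (cone_semigroup C) \<and> vertex C \<epsilon> = c)"

definition connecting_cone ::
  "('o, 'm, 'x) subobject_category_scheme \<Rightarrow> 'o \<Rightarrow> ('o \<Rightarrow> 'm) set \<Rightarrow> ('o \<Rightarrow> 'm)" where
  "connecting_cone C c d =
     (THE \<epsilon>. \<epsilon> \<in> d \<and> \<epsilon> \<in> idempotents (cone_semigroup C) \<and> vertex C \<epsilon> = c)"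

definition connected_category ::
  "('o, 'm, 'x) subobject_category_scheme \<Rightarrow> ('o \<Rightarrow> 'm) set set \<Rightarrow> bool" where
  "connected_category C D \<longleftrightarrow>
     normal_category C \<and> down_set C D \<and> (\<forall>c \<in> Obj C. \<exists>d \<in> D. connected_by C c d)"

definition supported_category ::
  "('o, 'm, 'x) subobject_category_scheme \<Rightarrow> ('o \<Rightarrow> 'm) set set \<Rightarrow> bool" where
  "supported_category C D \<longleftrightarrow>
     connected_category C D \<and> (\<forall>c \<in> Obj C. \<exists>!d. d \<in> D \<and> connected_by C c d)"

definition support_map ::
  "('o, 'm, 'x) subobject_category_scheme \<Rightarrow> ('o \<Rightarrow> 'm) set set \<Rightarrow> 'o \<Rightarrow> ('o \<Rightarrow> 'm) set" where
  "support_map C D c = (THE d. d \<in> D \<and> connected_by C c d)"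

definition self_supported_category ::
  "('o, 'm, 'x) subobject_category_scheme \<Rightarrow> ('o \<Rightarrow> 'm) set set \<Rightarrow> bool" where
  "self_supported_category C D \<longleftrightarrow>
     supported_category C D \<and>
     bij_betw (support_map C D) (Obj C) D \<and>
     (\<forall>a \<in> Obj C. \<forall>b \<in> Obj C. subobject C a b \<longleftrightarrow>
        R_le (cone_semigroup C) (support_map C D a) (support_map C D b))"

section \<open>CC-morphisms\<close>

text \<open>A functor is given by its object map \<open>Fo\<close> and its morphism map \<open>Fm\<close>.\<close>

locale category_functor =
  source: category C + target: category C'
  for C :: "('o, 'm, 'x) category_scheme" and C' :: "('p, 'n, 'y) category_scheme" +
  fixes Fo :: "'o \<Rightarrow> 'p" and Fm :: "'m \<Rightarrow> 'n"
  assumes maps_Obj: "c \<in> Obj C \<Longrightarrow> Fo c \<in> Obj C'"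
    and maps_Mor: "f \<in> Mor C a b \<Longrightarrow> Fm f \<in> Mor C' (Fo a) (Fo b)"
    and maps_Ide: "c \<in> Obj C \<Longrightarrow> Fm (Ide C c) = Ide C' (Fo c)"
    and maps_Comp: "f \<in> Mor C a b \<Longrightarrow> g \<in> Mor C b c \<Longrightarrow> Fm (f \<cdot>\<^bsub>C\<^esub> g) = Fm f \<cdot>\<^bsub>C'\<^esub> Fm g"

definition CC_morphism ::
  "('o, 'm, 'x) subobject_category_scheme \<Rightarrow> ('o \<Rightarrow> 'm) set set \<Rightarrow>
   ('p, 'n, 'y) subobject_category_scheme \<Rightarrow> ('p \<Rightarrow> 'n) set set \<Rightarrow>
   ('o \<Rightarrow> 'p) \<Rightarrow> ('m \<Rightarrow> 'n) \<Rightarrow> (('o \<Rightarrow> 'm) set \<Rightarrow> ('p \<Rightarrow> 'n) set) \<Rightarrow> bool" where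
  "CC_morphism C D C' D' Fo Fm G \<longleftrightarrow>
     connected_category C D \<and> connected_category C' D' \<and>
     category_functor C C' Fo Fm \<and> (\<forall>f \<in> Incl C. Fm f \<in> Incl C') \<and>
     G \<in> D \<rightarrow> D' \<and>
     (\<forall>d \<in> D. \<forall>e \<in> D. R_le (cone_semigroup C) d e \<longrightarrow> R_le (cone_semigroup C') (G d) (G e)) \<and>
     (\<forall>c \<in> Obj C. \<forall>d \<in> D. connected_by C c d \<longrightarrow>
        connected_by C' (Fo c) (G d) \<and>
        (\<forall>c' \<in> Obj C. Fm (connecting_cone C c d c') = connecting_cone C' (Fo c) (G d) (Fo c')))"

definition CC_isomorphic ::
  "('o, 'm, 'x) subobject_category_scheme \<Rightarrow> ('o \<Rightarrow> 'm) set set \<Rightarrow>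
   ('p, 'n, 'y) subobject_category_scheme \<Rightarrow> ('p \<Rightarrow> 'n) set set \<Rightarrow> bool" where
  "CC_isomorphic C D C' D' \<longleftrightarrow>
     (\<exists>Fo Fm G Fo' Fm' G'.
        CC_morphism C D C' D' Fo Fm G \<and> CC_morphism C' D' C D Fo' Fm' G' \<and>
        (\<forall>c \<in> Obj C. Fo' (Fo c) = c) \<and> (\<forall>c \<in> Obj C'. Fo (Fo' c) = c) \<and>
        (\<forall>f \<in> Arr C. Fm' (Fm f) = f) \<and> (\<forall>f \<in> Arr C'. Fm (Fm' f) = f) \<and>
        (\<forall>d \<in> D. G' (G d) = d) \<and> (\<forall>d \<in> D'. G (G' d) = d))"

definition isomorphic_self_supported ::
  "('o, 'm, 'x) subobject_category_scheme \<Rightarrow> ('o \<Rightarrow> 'm) set set \<Rightarrow>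
   ('p, 'n, 'y) subobject_category_scheme \<Rightarrow> ('p \<Rightarrow> 'n) set set \<Rightarrow> bool" where
  "isomorphic_self_supported C D C' D' \<longleftrightarrow>
     self_supported_category C D \<and> self_supported_category C' D' \<and> CC_isomorphic C D C' D'"

section \<open>The category of principal left ideals of a semigroup\<close>

definition left_ideal :: "('a, 'x) monoid_scheme \<Rightarrow> 'a \<Rightarrow> 'a set" where
  "left_ideal S e = {x \<otimes>\<^bsub>S\<^esub> e | x. x \<in> carrier S}"

text \<open>
  The mapping \<open>r(e, u, f) : Se \<rightarrow> Sf\<close>, \<open>x \<mapsto> x u\<close>, with its domain and codomain recorded.  Being
  extensional, two such triples are equal iff they are equal as mappings \<open>Se \<rightarrow> Sf\<close>.
\<close>

definition r_map ::
  "('a, 'x) monoid_scheme \<Rightarrow> 'a \<Rightarrow> 'a \<Rightarrow> 'a \<Rightarrow> 'a set \<times> ('a \<Rightarrow> 'a) \<times> 'a set" where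
  "r_map S e u f = (left_ideal S e, (\<lambda>x \<in> left_ideal S e. x \<otimes>\<^bsub>S\<^esub> u), left_ideal S f)"

definition left_ideal_category ::
  "('a, 'x) monoid_scheme \<Rightarrow> ('a set, 'a set \<times> ('a \<Rightarrow> 'a) \<times> 'a set) subobject_category" where
  "left_ideal_category S =
     \<lparr>Obj = {left_ideal S e | e. e \<in> idempotents S},
      Arr = {r_map S e u f | e u f. e \<in> idempotents S \<and> f \<in> idempotents S \<and>
               u \<in> {e \<otimes>\<^bsub>S\<^esub> s \<otimes>\<^bsub>S\<^esub> f | s. s \<in> carrier S}},
      Dom = (\<lambda>(A, \<phi>, B). A),
      Cod = (\<lambda>(A, \<phi>, B). B),
      Ide = (\<lambda>A. (A, \<lambda>x \<in> A. x, A)),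
      Comp = (\<lambda>(A, \<phi>, B) (B', \<psi>, C). (A, compose A \<psi> \<phi>, C)),
      Incl = {r_map S e e f | e f. e \<in> idempotents S \<and> f \<in> idempotents S \<and>
               left_ideal S e \<subseteq> left_ideal S f}\<rparr>"

section \<open>Partial bijections\<close>

definition partial_bijections :: "'a set \<Rightarrow> 'a set \<Rightarrow> ('a \<rightharpoonup> 'a) set" where
  "partial_bijections A B = {f. dom f \<subseteq> A \<and> ran f \<subseteq> B \<and> inj_on f (dom f)}"

text \<open>Since \<open>\<circ>\<^sub>m\<close> composes from right to left, its arguments are interchanged here.\<close>

definition symmetric_inverse_monoid :: "'a set \<Rightarrow> ('a \<rightharpoonup> 'a) monoid" where
  "symmetric_inverse_monoid X =
     \<lparr>carrier = partial_bijections X X,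
      mult = (\<lambda>f g. g \<circ>\<^sub>m f),
      one = Some |` X\<rparr>"

definition subset_category ::
  "'a set \<Rightarrow> ('a set, 'a set \<times> ('a \<rightharpoonup> 'a) \<times> 'a set) subobject_category" where
  "subset_category X =
     \<lparr>Obj = Pow X,
      Arr = {(A, f, B) | A f B. A \<subseteq> X \<and> B \<subseteq> X \<and> f \<in> partial_bijections A B},
      Dom = (\<lambda>(A, f, B). A),
      Cod = (\<lambda>(A, f, B). B),
      Ide = (\<lambda>A. (A, Some |` A, A)),
      Comp = (\<lambda>(A, f, B) (B', g, C). (A, g \<circ>\<^sub>m f, C)),
      Incl = {(A, Some |` A, B) | A B. A \<subseteq> B \<and> B \<subseteq> X}\<rparr>"

end

(*
  A cone over the subsets of X is determined by its component at the largest subset X, which is an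
  arbitrary partial bijection f of X, and its vertex is the image of f; multiplying cones is composing
  these partial bijections.  In the symmetric inverse monoid, principal right ideals, hence R-classes
  and their order, are given by the domain, and the idempotents are the partial identities; so A is
  connected by exactly the class of domain A.  The categories of subsets and of principal left ideals
  are isomorphic via A |-> S 1_A, and every notion involved is transported along this isomorphism.
*)

theory Submission
  imports Defs
begin

text \<open>Many of the notions are \<open>THE\<close> descriptions: inclusion, vertex, epimorphic
  part, connecting cone, support map. Each has to be pinned down before it can be carried along an
  isomorphism. For the epimorphic part this takes an argument, given for every category with
  subobjects. Two facts about cones are drawn from the concrete description by partial bijections
  instead of from general theory: products of cones are again cones, and an idempotent cone is
  determined by its vertex. This decides the direction of the proof. Everything is checked in the
  category of subsets; the category of left ideals receives its category laws, its normality and its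
  self-support by transport. The isomorphism therefore runs from subsets to left ideals and is
  reversed at the very end.\<close>

section \<open>Isomorphisms of semigroups\<close>

text \<open>Closure of the product is assumed separately because \<open>iso\<close> only says that
  products are preserved. It keeps principal right ideals inside the carrier, where
  \<open>\<phi>\<close> is injective, so that inclusions between ideals are reflected and not only
  preserved.\<close>

locale semigroup_iso =
  fixes S :: "('a, 'x) monoid_scheme" and T :: "('b, 'y) monoid_scheme" and \<phi> :: "'a \<Rightarrow> 'b"
  assumes iso: "\<phi> \<in> iso S T"
    and mult_closed: "a \<in> carrier S \<Longrightarrow> b \<in> carrier S \<Longrightarrow> a \<otimes>\<^bsub>S\<^esub> b \<in> carrier S"
begin

lemma inj: "inj_on \<phi> (carrier S)"
  and image: "\<phi> ` carrier S = carrier T"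
  and mult: "a \<in> carrier S \<Longrightarrow> b \<in> carrier S \<Longrightarrow> \<phi> (a \<otimes>\<^bsub>S\<^esub> b) = \<phi> a \<otimes>\<^bsub>T\<^esub> \<phi> b"
  using iso by (auto simp: iso_def hom_def bij_betw_def)

lemma image_closed: "a \<in> carrier S \<Longrightarrow> \<phi> a \<in> carrier T"
  using image by blast

lemma eq_iff: "a \<in> carrier S \<Longrightarrow> b \<in> carrier S \<Longrightarrow> \<phi> a = \<phi> b \<longleftrightarrow> a = b"
  using inj by (auto dest: inj_onD)

lemma target_mult_closed: "x \<in> carrier T \<Longrightarrow> y \<in> carrier T \<Longrightarrow> x \<otimes>\<^bsub>T\<^esub> y \<in> carrier T"
  unfolding image[symmetric] by (auto simp: mult[symmetric] mult_closed)

lemma inv_into_iso: "inv_into (carrier S) \<phi> \<in> iso T S"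
proof -
  let ?\<psi> = "inv_into (carrier S) \<phi>"
  have bij: "bij_betw \<phi> (carrier S) (carrier T)" using iso by (simp add: iso_def)
  have "?\<psi> (x \<otimes>\<^bsub>T\<^esub> y) = ?\<psi> x \<otimes>\<^bsub>S\<^esub> ?\<psi> y" if "x \<in> carrier T" "y \<in> carrier T" for x y
    using that unfolding image[symmetric]
    by (auto simp: mult[symmetric] mult_closed inv_into_f_f[OF inj])
  then show ?thesis
    using bij_betw_inv_into[OF bij] by (auto simp: iso_def hom_def bij_betw_def)
qed

lemma image_subset_iff:
  assumes "A \<subseteq> carrier S" "B \<subseteq> carrier S"
  shows "\<phi> ` A \<subseteq> \<phi> ` B \<longleftrightarrow> A \<subseteq> B"
  using assms inj by (blast dest: inj_onD)

lemma principal_right_ideal_closed: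
  "a \<in> carrier S \<Longrightarrow> principal_right_ideal S a \<subseteq> carrier S"
  by (auto simp: principal_right_ideal_def mult_closed)

lemma principal_right_ideal_image:
  assumes "a \<in> carrier S"
  shows "principal_right_ideal T (\<phi> a) = \<phi> ` principal_right_ideal S a"
proof -
  \<comment> \<open>Surjectivity of \<open>\<phi>\<close> turns every multiplier from
    \<open>T\<close> into the image of one from \<open>S\<close>.\<close>
  have "{\<phi> a \<otimes>\<^bsub>T\<^esub> t | t. t \<in> carrier T} = \<phi> ` {a \<otimes>\<^bsub>S\<^esub> s | s. s \<in> carrier S}"
    unfolding image[symmetric] using assms by (force simp: mult)
  then show ?thesis by (simp add: principal_right_ideal_def)
qed

lemma principal_right_ideal_subset_iff:
  assumes "a \<in> carrier S" "b \<in> carrier S"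
  shows "principal_right_ideal T (\<phi> a) \<subseteq> principal_right_ideal T (\<phi> b) \<longleftrightarrow>
    principal_right_ideal S a \<subseteq> principal_right_ideal S b"
  using image_subset_iff[OF principal_right_ideal_closed principal_right_ideal_closed] assms
  by (simp add: principal_right_ideal_image)

lemma green_R_iff:
  assumes "a \<in> carrier S" "b \<in> carrier S"
  shows "(\<phi> a, \<phi> b) \<in> green_R T \<longleftrightarrow> (a, b) \<in> green_R S"
  using assms by (auto simp: green_R_def image_closed set_eq_subset principal_right_ideal_subset_iff)

lemma green_R_class_image:
  assumes "a \<in> carrier S"
  shows "green_R T `` {\<phi> a} = \<phi> ` (green_R S `` {a})"
proof -
  have "b \<in> carrier T" if "(\<phi> a, b) \<in> green_R T" for b using that by (simp add: green_R_def)
  moreover have "b \<in> carrier S" if "(a, b) \<in> green_R S" for b using that by (simp add: green_R_def)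
  ultimately show ?thesis using green_R_iff[OF assms] unfolding image[symmetric] by blast
qed

lemma R_classes_image: "R_classes T = (`) \<phi> ` R_classes S"
  unfolding R_classes_def quotient_def image[symmetric] by (auto simp: green_R_class_image)

lemma R_class_closed: "d \<in> R_classes S \<Longrightarrow> d \<subseteq> carrier S"
  by (auto simp: R_classes_def quotient_def green_R_def)

lemma R_le_image_iff:
  assumes "d \<in> R_classes S" "e \<in> R_classes S"
  shows "R_le T (\<phi> ` d) (\<phi> ` e) \<longleftrightarrow> R_le S d e"
  unfolding R_le_def
  using R_class_closed[OF assms(1), THEN subsetD] R_class_closed[OF assms(2), THEN subsetD]
  by (simp add: principal_right_ideal_subset_iff cong: bex_cong)

lemma idempotent_iff: "a \<in> carrier S \<Longrightarrow> \<phi> a \<in> idempotents T \<longleftrightarrow> a \<in> idempotents S"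
  by (auto simp: idempotents_def image_closed mult[symmetric] mult_closed eq_iff)

lemma idempotents_image: "idempotents T = \<phi> ` idempotents S"
proof (intro equalityI subsetI)
  fix x assume x: "x \<in> idempotents T"
  then have "x \<in> \<phi> ` carrier S" unfolding image by (simp add: idempotents_def)
  then show "x \<in> \<phi> ` idempotents S" using x idempotent_iff by blast
next
  fix x assume "x \<in> \<phi> ` idempotents S"
  then obtain a where "a \<in> idempotents S" "x = \<phi> a" by blast
  moreover from this(1) have "a \<in> carrier S" by (simp add: idempotents_def)
  ultimately show "x \<in> idempotents T" using idempotent_iff by blast
qed

end

section \<open>Isomorphisms of categories\<close>

lemma (in category) Mor_Obj:
  assumes "f \<in> Mor C a b"
  shows "a \<in> Obj C" "b \<in> Obj C"
  using assms Dom_closed Cod_closed by (auto simp: Mor_def)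

text \<open>Only the source is assumed to be a category, and functoriality is assumed only of the
  forward maps. Since the backward maps invert them, the laws of \<open>C'\<close> and the
  functoriality of the inverse follow.\<close>

locale category_iso = category C
  for C :: "('o, 'm, 'x) category_scheme" +
  fixes C' :: "('p, 'n, 'y) category_scheme"
    and Fo :: "'o \<Rightarrow> 'p" and Fm :: "'m \<Rightarrow> 'n" and Go :: "'p \<Rightarrow> 'o" and Gm :: "'n \<Rightarrow> 'm"
  assumes Fo_Obj: "c \<in> Obj C \<Longrightarrow> Fo c \<in> Obj C'"
    and Go_Obj: "c' \<in> Obj C' \<Longrightarrow> Go c' \<in> Obj C"
    and Go_Fo: "c \<in> Obj C \<Longrightarrow> Go (Fo c) = c"
    and Fo_Go: "c' \<in> Obj C' \<Longrightarrow> Fo (Go c') = c'"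
    and Fm_Arr: "f \<in> Arr C \<Longrightarrow> Fm f \<in> Arr C'"
    and Gm_Arr: "f' \<in> Arr C' \<Longrightarrow> Gm f' \<in> Arr C"
    and Gm_Fm: "f \<in> Arr C \<Longrightarrow> Gm (Fm f) = f"
    and Fm_Gm: "f' \<in> Arr C' \<Longrightarrow> Fm (Gm f') = f'"
    and Dom_Fm: "f \<in> Arr C \<Longrightarrow> Dom C' (Fm f) = Fo (Dom C f)"
    and Cod_Fm: "f \<in> Arr C \<Longrightarrow> Cod C' (Fm f) = Fo (Cod C f)"
    and Fm_Ide: "c \<in> Obj C \<Longrightarrow> Fm (Ide C c) = Ide C' (Fo c)"
    and Fm_Comp: "f \<in> Arr C \<Longrightarrow> g \<in> Arr C \<Longrightarrow> Cod C f = Dom C g \<Longrightarrow>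
      Fm (f \<cdot>\<^bsub>C\<^esub> g) = Fm f \<cdot>\<^bsub>C'\<^esub> Fm g"
begin

lemma Fm_Mor: "f \<in> Mor C a b \<Longrightarrow> Fm f \<in> Mor C' (Fo a) (Fo b)"
  by (auto simp: Mor_def Fm_Arr Dom_Fm Cod_Fm)

lemma Dom_Gm: "f' \<in> Arr C' \<Longrightarrow> Dom C (Gm f') = Go (Dom C' f')"
  using Dom_Fm[of "Gm f'"] by (simp add: Gm_Arr Fm_Gm Go_Fo Dom_closed)

lemma Cod_Gm: "f' \<in> Arr C' \<Longrightarrow> Cod C (Gm f') = Go (Cod C' f')"
  using Cod_Fm[of "Gm f'"] by (simp add: Gm_Arr Fm_Gm Go_Fo Cod_closed)

lemma Gm_Mor: "f' \<in> Mor C' a b \<Longrightarrow> Gm f' \<in> Mor C (Go a) (Go b)"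
  by (auto simp: Mor_def Gm_Arr Dom_Gm Cod_Gm)

lemma target_Arr_cases:
  assumes "f' \<in> Arr C'"
  obtains f where "f \<in> Arr C" "f' = Fm f"
  using assms Gm_Arr Fm_Gm by metis

lemma target_Dom_closed: "f' \<in> Arr C' \<Longrightarrow> Dom C' f' \<in> Obj C'"
  by (metis target_Arr_cases Dom_Fm Fo_Obj Dom_closed)

lemma target_Cod_closed: "f' \<in> Arr C' \<Longrightarrow> Cod C' f' \<in> Obj C'"
  by (metis target_Arr_cases Cod_Fm Fo_Obj Cod_closed)

lemma target_Mor_cases:
  assumes "f' \<in> Mor C' a' b'"
  obtains f where "f \<in> Mor C (Go a') (Go b')" "f' = Fm f"
proof
  show "Gm f' \<in> Mor C (Go a') (Go b')" using assms by (rule Gm_Mor)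
  show "f' = Fm (Gm f')" using assms by (simp add: Mor_def Fm_Gm)
qed

lemma Fm_Comp_Mor: "f \<in> Mor C a b \<Longrightarrow> g \<in> Mor C b c \<Longrightarrow> Fm (f \<cdot>\<^bsub>C\<^esub> g) = Fm f \<cdot>\<^bsub>C'\<^esub> Fm g"
  by (simp add: Mor_def Fm_Comp)

lemma target_Mor_Obj: "f' \<in> Mor C' a b \<Longrightarrow> a \<in> Obj C' \<and> b \<in> Obj C'"
  by (auto simp: Mor_def target_Dom_closed target_Cod_closed)

text \<open>Every arrow of \<open>C'\<close> is \<open>Fm\<close> of an arrow between the
  corresponding objects of \<open>C\<close>, so each law is the image of the same law in
  \<open>C\<close>.\<close>

lemma target_category: "category C'"
proof
  show "Ide C' a \<in> Mor C' a a" if "a \<in> Obj C'" for a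
    using Fm_Mor[OF Ide_closed[OF Go_Obj[OF that]]] that by (simp add: Fm_Ide Fo_Go Go_Obj)
  show "f \<cdot>\<^bsub>C'\<^esub> g \<in> Mor C' a c" if fg: "f \<in> Mor C' a b" "g \<in> Mor C' b c" for f g a b c
  proof -
    note ob = target_Mor_Obj[OF fg(1)] target_Mor_Obj[OF fg(2)]
    obtain f0 g0 where *: "f0 \<in> Mor C (Go a) (Go b)" "f = Fm f0" "g0 \<in> Mor C (Go b) (Go c)" "g = Fm g0"
      using fg by (metis target_Mor_cases)
    show ?thesis using Fm_Mor[OF Comp_closed[OF *(1,3)]] * ob
      by (simp add: Fm_Comp_Mor[OF *(1,3)] Fo_Go)
  qed
  show "Ide C' a \<cdot>\<^bsub>C'\<^esub> f = f" if f: "f \<in> Mor C' a b" for f a b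
  proof -
    note ob = target_Mor_Obj[OF f]
    obtain f0 where *: "f0 \<in> Mor C (Go a) (Go b)" "f = Fm f0" using f by (rule target_Mor_cases)
    show ?thesis
      using Fm_Comp_Mor[OF Ide_closed *(1)] Ide_left[OF *(1)] * ob by (simp add: Fm_Ide Fo_Go Go_Obj)
  qed
  show "f \<cdot>\<^bsub>C'\<^esub> Ide C' b = f" if f: "f \<in> Mor C' a b" for f a b
  proof -
    note ob = target_Mor_Obj[OF f]
    obtain f0 where *: "f0 \<in> Mor C (Go a) (Go b)" "f = Fm f0" using f by (rule target_Mor_cases)
    show ?thesis
      using Fm_Comp_Mor[OF *(1) Ide_closed] Ide_right[OF *(1)] * ob by (simp add: Fm_Ide Fo_Go Go_Obj)
  qed
  show "f \<cdot>\<^bsub>C'\<^esub> g \<cdot>\<^bsub>C'\<^esub> h = f \<cdot>\<^bsub>C'\<^esub> (g \<cdot>\<^bsub>C'\<^esub> h)"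
    if fgh: "f \<in> Mor C' a b" "g \<in> Mor C' b c" "h \<in> Mor C' c d" for f g h a b c d
  proof -
    obtain f0 g0 h0 where *: "f0 \<in> Mor C (Go a) (Go b)" "f = Fm f0" "g0 \<in> Mor C (Go b) (Go c)" "g = Fm g0"
      "h0 \<in> Mor C (Go c) (Go d)" "h = Fm h0"
      using fgh by (metis target_Mor_cases)
    note comps = Comp_closed[OF *(1,3)] Comp_closed[OF *(3,5)]
    show ?thesis
      unfolding *(2,4,6)
      by (simp add: Comp_assoc[OF *(1,3,5)] Fm_Comp_Mor[OF *(1,3), symmetric]
          Fm_Comp_Mor[OF *(3,5), symmetric] Fm_Comp_Mor[OF comps(1) *(5), symmetric]
          Fm_Comp_Mor[OF *(1) comps(2), symmetric])
  qed
qed (simp_all add: target_Dom_closed target_Cod_closed)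

lemma Gm_Ide: "c' \<in> Obj C' \<Longrightarrow> Gm (Ide C' c') = Ide C (Go c')"
proof -
  assume c: "c' \<in> Obj C'"
  have "Ide C (Go c') \<in> Arr C" using Ide_closed[OF Go_Obj[OF c]] by (simp add: Mor_def)
  then show ?thesis using Fm_Ide[OF Go_Obj[OF c]] c Gm_Fm by (metis Fo_Go)
qed

lemma Gm_Comp:
  assumes "f' \<in> Arr C'" "g' \<in> Arr C'" "Cod C' f' = Dom C' g'"
  shows "Gm (f' \<cdot>\<^bsub>C'\<^esub> g') = Gm f' \<cdot>\<^bsub>C\<^esub> Gm g'"
proof -
  have *: "Gm f' \<in> Mor C (Go (Dom C' f')) (Go (Cod C' f'))"
    "Gm g' \<in> Mor C (Go (Cod C' f')) (Go (Cod C' g'))"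
    using assms by (auto simp: Mor_def Gm_Arr Dom_Gm Cod_Gm)
  then show ?thesis
    using Comp_closed[OF *] Fm_Comp_Mor[OF *] assms Gm_Fm[of "Gm f' \<cdot>\<^bsub>C\<^esub> Gm g'"]
    by (simp add: Mor_def Fm_Gm)
qed

text \<open>Makes the situation symmetric: every one-way transport result now also holds backwards,
  which yields the equivalences.\<close>

lemma inverse: "category_iso C' C Go Gm Fo Fm"
  by (intro category_iso.intro category_iso_axioms.intro target_category)
    (simp_all add: Fo_Obj Go_Obj Fo_Go Go_Fo Fm_Arr Gm_Arr Fm_Gm Gm_Fm Dom_Gm Cod_Gm Gm_Ide Gm_Comp)

lemma isomorphism_Fm:
  assumes "isomorphism C f"
  shows "isomorphism C' (Fm f)"
proof -
  obtain g where *: "f \<in> Arr C" "g \<in> Mor C (Cod C f) (Dom C f)"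
    "f \<cdot>\<^bsub>C\<^esub> g = Ide C (Dom C f)" "g \<cdot>\<^bsub>C\<^esub> f = Ide C (Cod C f)"
    using assms by (auto simp: isomorphism_def)
  then have "Fm f \<cdot>\<^bsub>C'\<^esub> Fm g = Ide C' (Fo (Dom C f))" "Fm g \<cdot>\<^bsub>C'\<^esub> Fm f = Ide C' (Fo (Cod C f))"
    using Fm_Ide Fm_Comp[of f g] Fm_Comp[of g f] by (simp_all add: Mor_def Dom_closed Cod_closed)
  then show ?thesis
    unfolding isomorphism_def using * Fm_Mor[OF *(2)] by (auto simp: Fm_Arr Dom_Fm Cod_Fm)
qed

lemma monomorphism_Fm:
  assumes "monomorphism C f"
  shows "monomorphism C' (Fm f)"
  unfolding monomorphism_def
proof (intro conjI allI ballI impI)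
  have f: "f \<in> Arr C" using assms by (simp add: monomorphism_def)
  then show "Fm f \<in> Arr C'" by (rule Fm_Arr)
  fix a g h
  assume gh: "g \<in> Mor C' a (Dom C' (Fm f))" "h \<in> Mor C' a (Dom C' (Fm f))"
    and eq: "g \<cdot>\<^bsub>C'\<^esub> Fm f = h \<cdot>\<^bsub>C'\<^esub> Fm f"
  \<comment> \<open>The two test arrows are pulled back to \<open>C\<close>, where \<open>f\<close>
    can be cancelled.\<close>
  have *: "Gm g \<in> Mor C (Go a) (Dom C f)" "Gm h \<in> Mor C (Go a) (Dom C f)"
    using gh f Gm_Mor by (auto simp: Dom_Fm Go_Fo Dom_closed dest!: Gm_Mor)
  have "Gm (g \<cdot>\<^bsub>C'\<^esub> Fm f) = Gm g \<cdot>\<^bsub>C\<^esub> f" "Gm (h \<cdot>\<^bsub>C'\<^esub> Fm f) = Gm h \<cdot>\<^bsub>C\<^esub> f"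
    using gh f Gm_Comp by (auto simp: Mor_def Fm_Arr Gm_Fm)
  then have "Gm g = Gm h" using assms * eq by (auto simp: monomorphism_def)
  then show "g = h" using gh Fm_Gm by (auto simp: Mor_def) metis
qed

text \<open>Meant for the categories of inclusions, between which the same maps form an
  isomorphism.\<close>

lemma strict_preorder_target:
  assumes "strict_preorder C"
  shows "strict_preorder C'"
proof (intro strict_preorder.intro strict_preorder_axioms.intro target_category)
  show "f = g" if "f \<in> Mor C' a b" "g \<in> Mor C' a b" for f g a b
    using that strict_preorder.at_most_one[OF assms] by (metis target_Mor_cases)
  show "f = Ide C' (Dom C' f)" if f: "isomorphism C' f" for f
  proof -
    have A: "f \<in> Arr C'" using f by (simp add: isomorphism_def)
    have "Gm f = Ide C (Dom C (Gm f))"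
      using strict_preorder.iso_is_identity[OF assms] category_iso.isomorphism_Fm[OF inverse f] by blast
    then show ?thesis
      using A by (metis Dom_Fm Dom_closed Fm_Gm Fm_Ide Gm_Arr)
  qed
qed

end

section \<open>Uniqueness of the epimorphic part\<close>

lemma inclusions_simps [simp]:
  "Obj (inclusions C) = Obj C" "Arr (inclusions C) = Incl C"
  "Dom (inclusions C) = Dom C" "Cod (inclusions C) = Cod C"
  "Ide (inclusions C) = Ide C" "Comp (inclusions C) = Comp C"
  by (simp_all add: inclusions_def)

context category_with_subobjects
begin

lemma Mor_inclusions: "f \<in> Mor (inclusions C) a b \<longleftrightarrow> f \<in> Incl C \<and> Dom C f = a \<and> Cod C f = b"
  by (simp add: Mor_def)

lemma subobject_iff: "subobject C a b \<longleftrightarrow> (\<exists>j \<in> Incl C. Dom C j = a \<and> Cod C j = b)"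
  unfolding subobject_def using Mor_inclusions by blast

lemma Incl_eqI:
  assumes "f \<in> Incl C" "g \<in> Incl C" "Dom C f = Dom C g" "Cod C f = Cod C g"
  shows "f = g"
  using assms strict_preorder.at_most_one[OF strict_preorder_inclusions] Mor_inclusions by metis

lemma inclusion_eqI:
  assumes "j \<in> Incl C"
  shows "inclusion C (Dom C j) (Cod C j) = j"
  unfolding inclusion_def using assms Incl_eqI by (intro the_equality) (auto simp: Mor_inclusions)

lemma Ide_Incl: "a \<in> Obj C \<Longrightarrow> Ide C a \<in> Incl C"
  using category.Ide_closed[OF strict_preorder.axioms(1)[OF strict_preorder_inclusions], of a]
  by (simp add: Mor_def)

lemma Incl_Comp:
  assumes "f \<in> Incl C" "g \<in> Incl C" "Cod C f = Dom C g"
  shows "f \<cdot> g \<in> Incl C"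
  using assms category.Comp_closed[OF strict_preorder.axioms(1)[OF strict_preorder_inclusions],
      of f "Dom C f" "Cod C f" g "Cod C g"]
  by (simp add: Mor_def)

text \<open>Both composites are inclusions parallel to identities, hence equal to them. So
  \<open>f\<close> is invertible among the inclusions, and a strict preorder has no isomorphisms but
  identities.\<close>

lemma Incl_antisym:
  assumes "f \<in> Incl C" "g \<in> Incl C" "Dom C g = Cod C f" "Cod C g = Dom C f"
  shows "f = Ide C (Dom C f)"
proof -
  have ob: "Dom C f \<in> Obj C" "Cod C f \<in> Obj C"
    using assms(1) Incl_subset Dom_closed Cod_closed by auto
  have F: "f \<in> Mor C (Dom C f) (Cod C f)" "g \<in> Mor C (Cod C f) (Dom C f)"
    using assms Incl_subset by (auto simp: Mor_def)
  have "f \<cdot> g = Ide C (Dom C f)" "g \<cdot> f = Ide C (Cod C f)"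
    using assms F Ide_closed[OF ob(1)] Ide_closed[OF ob(2)] Comp_closed[OF F] Comp_closed[OF F(2,1)]
    by (auto intro!: Incl_eqI Incl_Comp Ide_Incl ob simp: Mor_def)
  then have "isomorphism (inclusions C) f"
    using assms by (simp add: isomorphism_def Mor_def) metis
  then show ?thesis
    using strict_preorder.iso_is_identity[OF strict_preorder_inclusions]
    by fastforce
qed

text \<open>Besides the three factors this supplies a section \<open>i\<close> of the retraction and
  the inverse \<open>k\<close> of the isomorphism; the factors run through the objects
  \<open>a\<close>, \<open>w\<close>, \<open>v\<close>, \<open>b\<close> in this order.\<close>

lemma normal_factorisationE:
  assumes "normal_factorisation C f q u j"
  obtains i k a b v w where
    "i \<in> Mor C w a" "q \<in> Mor C a w" "i \<cdot> q = Ide C w" "u \<in> Mor C w v" "k \<in> Mor C v w"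
    "u \<cdot> k = Ide C w" "k \<cdot> u = Ide C v" "j \<in> Mor C v b" "j \<in> Incl C" "f = q \<cdot> u \<cdot> j"
proof -
  obtain i where i: "i \<in> Incl C" "q \<in> Mor C (Cod C i) (Dom C i)" "i \<cdot> q = Ide C (Dom C i)"
    using assms by (auto simp: normal_factorisation_def retraction_def retraction_of_def)
  obtain k where k: "k \<in> Mor C (Cod C u) (Dom C u)"
    "u \<cdot> k = Ide C (Dom C u)" "k \<cdot> u = Ide C (Cod C u)"
    using assms by (auto simp: normal_factorisation_def isomorphism_def)
  show ?thesis
    by (rule that[of i "Dom C i" "Cod C i" "Cod C u" k "Cod C j"])
      (use assms i k Incl_subset in \<open>auto simp: normal_factorisation_def isomorphism_def Mor_def\<close>)
qed

text \<open>The arrow \<open>k \<cdot> i\<close> is a left inverse of \<open>q \<cdot> u\<close>, so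
  composing it with \<open>f\<close> gives \<open>j\<close>. Writing \<open>f\<close> by its second
  factorisation exhibits \<open>j\<close> as a product ending in \<open>j'\<close>, and the other
  factor \<open>h\<close> is an inclusion by \<open>inclusion_factor\<close>.\<close>

lemma normal_factorisation_image_le:
  assumes "normal_factorisation C f q u j" "normal_factorisation C f q' u' j'"
  shows "\<exists>h \<in> Incl C. Dom C h = Dom C j \<and> Cod C h = Dom C j' \<and> h \<cdot> j' = j"
proof -
  obtain i k a b v w where 1:
    "i \<in> Mor C w a" "q \<in> Mor C a w" "i \<cdot> q = Ide C w" "u \<in> Mor C w v" "k \<in> Mor C v w"
    "u \<cdot> k = Ide C w" "k \<cdot> u = Ide C v" "j \<in> Mor C v b" "j \<in> Incl C" "f = q \<cdot> u \<cdot> j"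
    using assms(1) by (rule normal_factorisationE)
  obtain a' b' v' w' where 2: "q' \<in> Mor C a' w'" "u' \<in> Mor C w' v'"
    "j' \<in> Mor C v' b'" "j' \<in> Incl C" "f = q' \<cdot> u' \<cdot> j'"
    using assms(2) by (rule normal_factorisationE)
  have f: "f \<in> Mor C a b" using 1 by (auto intro: Comp_closed)
  have "f \<in> Mor C a' b'" unfolding 2(5) using 2 by (auto intro: Comp_closed)
  then have [simp]: "a' = a" "b' = b" using f by (auto simp: Mor_def)
  have qu': "q' \<cdot> u' \<in> Mor C a v'" using 2 by (auto intro: Comp_closed)
  have ki: "k \<cdot> i \<in> Mor C v a" using 1 by (auto intro: Comp_closed)
  define h where "h = k \<cdot> i \<cdot> (q' \<cdot> u')"
  have h: "h \<in> Mor C v v'" unfolding h_def using ki qu' by (auto intro: Comp_closed)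
  have uj: "u \<cdot> j \<in> Mor C w b" using 1 by (auto intro: Comp_closed)
  have "h \<cdot> j' = k \<cdot> i \<cdot> f"
    unfolding h_def 2(5) using Comp_assoc[OF ki qu'] 2 by simp
  also have "\<dots> = k \<cdot> (i \<cdot> (q \<cdot> (u \<cdot> j)))"
    using Comp_assoc[OF 1(5,1) f] Comp_assoc[OF 1(2,4,8)] 1(10) by simp
  also have "i \<cdot> (q \<cdot> (u \<cdot> j)) = u \<cdot> j"
    using Comp_assoc[OF 1(1,2) uj] 1(3) Ide_left[OF uj] by simp
  also have "k \<cdot> (u \<cdot> j) = j"
    using Comp_assoc[OF 1(5,4,8)] 1(7) Ide_left[OF 1(8)] by simp
  finally have hj: "h \<cdot> j' = j" .
  then have "h \<in> Incl C"
    using inclusion_factor[OF 1(9) 2(4), of h] h 2(3) by (auto simp: Mor_def)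
  then show ?thesis using h hj 1(8) 2(3) by (auto simp: Mor_def)
qed

text \<open>The image inclusions of two normal factorisations factor through each other, so by
  antisymmetry they coincide; being a monomorphism, the common inclusion can be cancelled. This
  makes the \<open>THE\<close> in \<open>epi_part\<close> determinate.\<close>

lemma epi_part_eqI:
  assumes "normal_factorisation C f q u j"
  shows "epi_part C f = q \<cdot> u"
  unfolding epi_part_def
proof (rule the_equality)
  show "\<exists>q' u' j'. normal_factorisation C f q' u' j' \<and> q \<cdot> u = q' \<cdot> u'" using assms by blast
  fix e assume "\<exists>q u j. normal_factorisation C f q u j \<and> e = q \<cdot> u"
  then obtain q' u' j' where nf: "normal_factorisation C f q' u' j'" and e: "e = q' \<cdot> u'" by blast
  obtain h h' where h: "h \<in> Incl C" "Dom C h = Dom C j" "Cod C h = Dom C j'" "h \<cdot> j' = j"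
    and h': "h' \<in> Incl C" "Dom C h' = Dom C j'" "Cod C h' = Dom C j"
    using normal_factorisation_image_le[OF assms nf] normal_factorisation_image_le[OF nf assms] by auto
  have "h = Ide C (Dom C j)" using Incl_antisym[OF h(1) h'(1)] h h' by simp
  obtain a b v w where 1: "q \<in> Mor C a w" "u \<in> Mor C w v" "j \<in> Mor C v b" "j \<in> Incl C" "f = q \<cdot> u \<cdot> j"
    using assms by (rule normal_factorisationE)
  obtain a' b' v' w' where 2: "q' \<in> Mor C a' w'" "u' \<in> Mor C w' v'" "j' \<in> Mor C v' b'" "f = q' \<cdot> u' \<cdot> j'"
    using nf by (rule normal_factorisationE)
  have hid: "h = Ide C v" using \<open>h = _\<close> 1 by (simp add: Mor_def)
  have "v \<in> Obj C" using Mor_Obj[OF 1(3)] by simp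
  then have vv: "v' = v" using hid h(3) Ide_closed[of v] 2(3) by (auto simp: Mor_def)
  then have jj: "j' = j" using h(4) hid Ide_left 2(3) by simp
  have qu: "q \<cdot> u \<in> Mor C a v" "q' \<cdot> u' \<in> Mor C a' v" using 1 2 vv by (auto intro: Comp_closed)
  have "f \<in> Mor C a b" unfolding 1(5) by (rule Comp_closed[OF qu(1) 1(3)])
  moreover have "f \<in> Mor C a' b'"
    unfolding 2(4) using Comp_closed[OF qu(2), of j' b'] 2(3) vv by simp
  ultimately have "a' = a" by (auto simp: Mor_def)
  then show "e = q \<cdot> u"
    using inclusion_mono[OF 1(4)] qu 1 2 jj unfolding e monomorphism_def Mor_def by auto
qed

end

text \<open>The vertex can be read off as the codomain of any one component.\<close>

lemma (in category_with_subobjects) vertex_eqI: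
  assumes "cone_with_vertex C z \<gamma>"
  shows "vertex C \<gamma> = z"
  unfolding vertex_def
proof (rule the_equality)
  fix z' assume "cone_with_vertex C z' \<gamma>"
  with assms have "z \<in> Obj C" "\<gamma> z \<in> Mor C z z" "\<gamma> z \<in> Mor C z z'"
    by (auto simp: cone_with_vertex_def)
  then show "z' = z" by (simp add: Mor_def)
qed fact

section \<open>Isomorphisms of categories with subobjects\<close>

text \<open>The restriction to \<open>Obj C'\<close> makes transported cones extensional, as
  \<open>cone_with_vertex\<close> demands, so that transport forth and back is an equality of
  functions.\<close>

definition transport_cone ::
  "('p, 'n, 'y) subobject_category_scheme \<Rightarrow> ('m \<Rightarrow> 'n) \<Rightarrow> ('p \<Rightarrow> 'o) \<Rightarrow> ('o \<Rightarrow> 'm) \<Rightarrow> ('p \<Rightarrow> 'n)" where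
  "transport_cone C' Fm Go \<gamma> = (\<lambda>c' \<in> Obj C'. Fm (\<gamma> (Go c')))"

text \<open>Inclusions are to be reflected as well as preserved; this makes the backward maps
  preserve them too.\<close>

locale subobject_category_iso = category_with_subobjects C + category_iso C C' Fo Fm Go Gm
  for C :: "('o, 'm, 'x) subobject_category_scheme"
    and C' :: "('p, 'n, 'y) subobject_category_scheme"
    and Fo Fm Go Gm +
  assumes target_Incl_subset: "Incl C' \<subseteq> Arr C'"
    and Fm_Incl_iff: "f \<in> Arr C \<Longrightarrow> Fm f \<in> Incl C' \<longleftrightarrow> f \<in> Incl C"
begin

abbreviation \<tau> where "\<tau> \<equiv> transport_cone C' Fm Go"

lemma Fm_Incl: "f \<in> Incl C \<Longrightarrow> Fm f \<in> Incl C'"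
  using Fm_Incl_iff Incl_subset by auto

lemma Gm_Incl: "f \<in> Incl C' \<Longrightarrow> Gm f \<in> Incl C"
  using Fm_Incl_iff[of "Gm f"] target_Incl_subset Gm_Arr Fm_Gm by auto

lemma inclusions_iso: "category_iso (inclusions C) (inclusions C') Fo Fm Go Gm"
proof (intro category_iso.intro category_iso_axioms.intro)
  show "category (inclusions C)"
    by (rule strict_preorder.axioms(1)[OF strict_preorder_inclusions])
qed (use Incl_subset target_Incl_subset in
    \<open>auto simp: Fo_Obj Go_Obj Fo_Go Go_Fo Fm_Gm Gm_Fm Dom_Fm Cod_Fm
      Fm_Ide Fm_Comp Fm_Incl Gm_Incl subset_iff\<close>)

lemma target_with_subobjects: "category_with_subobjects C'"
proof (intro category_with_subobjects.intro category_with_subobjects_axioms.intro target_category)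
  show "strict_preorder (inclusions C')"
    by (rule category_iso.strict_preorder_target[OF inclusions_iso strict_preorder_inclusions])
  show "monomorphism C' f" if f: "f \<in> Incl C'" for f
    using monomorphism_Fm[OF inclusion_mono[OF Gm_Incl[OF f]]] f target_Incl_subset Fm_Gm by auto
  show "h \<in> Incl C'" if *: "f \<in> Incl C'" "g \<in> Incl C'" "h \<in> Arr C'" "Cod C' h = Dom C' g"
    "f = h \<cdot>\<^bsub>C'\<^esub> g" for f g h
  proof -
    have g: "g \<in> Arr C'" using *(2) target_Incl_subset by auto
    have "Gm h \<in> Incl C"
      by (rule inclusion_factor[OF Gm_Incl[OF *(1)] Gm_Incl[OF *(2)]])
        (use * g in \<open>simp_all add: Gm_Arr Cod_Gm Dom_Gm Gm_Comp\<close>)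
    then show ?thesis using Fm_Incl Fm_Gm *(3) by metis
  qed
qed (rule target_Incl_subset)

lemma inverse_subobject: "subobject_category_iso C' C Go Gm Fo Fm"
  by (intro subobject_category_iso.intro subobject_category_iso_axioms.intro
      target_with_subobjects inverse Incl_subset)
    (metis Fm_Gm Fm_Incl Gm_Incl)

lemma subobject_Fo: "subobject C a b \<Longrightarrow> subobject C' (Fo a) (Fo b)"
  unfolding subobject_iff category_with_subobjects.subobject_iff[OF target_with_subobjects]
  using Fm_Incl Incl_subset Dom_Fm Cod_Fm by (metis subset_iff)

lemma subobject_Fo_iff:
  assumes "a \<in> Obj C" "b \<in> Obj C"
  shows "subobject C' (Fo a) (Fo b) \<longleftrightarrow> subobject C a b"
  using subobject_Fo[of a b] subobject_category_iso.subobject_Fo[OF inverse_subobject, of "Fo a" "Fo b"]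
  by (auto simp: Go_Fo assms)

lemma Fm_inclusion:
  assumes "subobject C a b"
  shows "Fm (inclusion C a b) = inclusion C' (Fo a) (Fo b)"
proof -
  obtain j where j: "j \<in> Incl C" "Dom C j = a" "Cod C j = b" using assms subobject_iff by auto
  then show ?thesis
    using inclusion_eqI[OF j(1)] Incl_subset
      category_with_subobjects.inclusion_eqI[OF target_with_subobjects Fm_Incl[OF j(1)]]
    by (auto simp: Dom_Fm Cod_Fm subset_iff)
qed

lemma inclusion_Mor: "subobject C a b \<Longrightarrow> inclusion C a b \<in> Mor C a b"
  using inclusion_eqI Incl_subset by (auto simp: subobject_iff Mor_def)

lemma retraction_of_Fm:
  assumes "retraction_of C j q"
  shows "retraction_of C' (Fm j) (Fm q)"
proof -
  have j: "j \<in> Incl C" "j \<in> Arr C" "q \<in> Mor C (Cod C j) (Dom C j)" "j \<cdot>\<^bsub>C\<^esub> q = Ide C (Dom C j)"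
    using assms Incl_subset by (auto simp: retraction_of_def)
  then have "Fm j \<cdot>\<^bsub>C'\<^esub> Fm q = Ide C' (Fo (Dom C j))"
    using Fm_Comp[of j q] Fm_Ide by (simp add: Mor_def Dom_closed)
  then show ?thesis using j Fm_Mor[OF j(3)] by (simp add: retraction_of_def Fm_Incl Dom_Fm Cod_Fm)
qed

text \<open>The second conjunct concerns the initial part of the factorisation, which is the
  epimorphic part; it is what lets \<open>epi_part\<close> commute with \<open>Fm\<close>.\<close>

lemma normal_factorisation_Fm:
  assumes "normal_factorisation C f q u j"
  shows "normal_factorisation C' (Fm f) (Fm q) (Fm u) (Fm j) \<and>
    Fm (q \<cdot>\<^bsub>C\<^esub> u) = Fm q \<cdot>\<^bsub>C'\<^esub> Fm u"
proof -
  have *: "retraction C q" "isomorphism C u" "j \<in> Incl C" "Cod C q = Dom C u" "Cod C u = Dom C j"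
    "f = q \<cdot>\<^bsub>C\<^esub> u \<cdot>\<^bsub>C\<^esub> j"
    using assms by (auto simp: normal_factorisation_def)
  have A: "q \<in> Arr C" "u \<in> Arr C" "j \<in> Arr C"
    using * Incl_subset by (auto simp: retraction_def retraction_of_def isomorphism_def Mor_def)
  have qu: "q \<cdot>\<^bsub>C\<^esub> u \<in> Mor C (Dom C q) (Cod C u)"
    by (rule Comp_closed[where b = "Dom C u"]) (use * A in \<open>auto simp: Mor_def\<close>)
  have "retraction C' (Fm q)" using *(1) retraction_of_Fm by (auto simp: retraction_def)
  then show ?thesis
    using * A qu isomorphism_Fm Fm_Incl Fm_Comp[of q u] Fm_Comp[of "q \<cdot>\<^bsub>C\<^esub> u" j]
    by (simp add: normal_factorisation_def Dom_Fm Cod_Fm Mor_def)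
qed

lemma cone_transport:
  assumes "cone_with_vertex C z \<gamma>"
  shows "cone_with_vertex C' (Fo z) (\<tau> \<gamma>)"
  unfolding cone_with_vertex_def
proof (intro conjI ballI impI)
  have \<gamma>: "z \<in> Obj C" "\<And>c. c \<in> Obj C \<Longrightarrow> \<gamma> c \<in> Mor C c z"
    "\<And>a b. a \<in> Obj C \<Longrightarrow> b \<in> Obj C \<Longrightarrow> subobject C a b \<Longrightarrow> inclusion C a b \<cdot>\<^bsub>C\<^esub> \<gamma> b = \<gamma> a"
    "\<exists>c \<in> Obj C. isomorphism C (\<gamma> c)"
    using assms by (auto simp: cone_with_vertex_def)
  show "Fo z \<in> Obj C'" by (rule Fo_Obj) fact
  show "\<tau> \<gamma> \<in> (\<Pi>\<^sub>E c \<in> Obj C'. Mor C' c (Fo z))"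
    using Fm_Mor[OF \<gamma>(2)[OF Go_Obj]] by (auto simp: transport_cone_def Fo_Go)
  show "inclusion C' a b \<cdot>\<^bsub>C'\<^esub> \<tau> \<gamma> b = \<tau> \<gamma> a"
    if ab: "a \<in> Obj C'" "b \<in> Obj C'" "subobject C' a b" for a b
  proof -
    have s: "subobject C (Go a) (Go b)"
      using ab subobject_Fo_iff[of "Go a" "Go b"] by (simp add: Go_Obj Fo_Go)
    then have "Fm (inclusion C (Go a) (Go b)) = inclusion C' a b"
      using Fm_inclusion ab by (simp add: Fo_Go)
    then show ?thesis
      using \<gamma>(3)[OF Go_Obj Go_Obj s] Fm_Comp_Mor[OF inclusion_Mor[OF s] \<gamma>(2)[OF Go_Obj]] ab
      by (simp add: transport_cone_def)
  qed
  obtain c where "c \<in> Obj C" "isomorphism C (\<gamma> c)" using \<gamma>(4) by blast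
  then show "\<exists>c \<in> Obj C'. isomorphism C' (\<tau> \<gamma> c)"
    using isomorphism_Fm Fo_Obj Go_Fo by (force simp: transport_cone_def)
qed

lemma vertex_transport: "\<gamma> \<in> cones C \<Longrightarrow> vertex C' (\<tau> \<gamma>) = Fo (vertex C \<gamma>)"
  using vertex_eqI category_with_subobjects.vertex_eqI[OF target_with_subobjects] cone_transport
  by (fastforce simp: cones_def)

lemma transport_cones: "\<gamma> \<in> cones C \<Longrightarrow> \<tau> \<gamma> \<in> cones C'"
  using cone_transport by (auto simp: cones_def)

lemma transport_inverse:
  assumes "\<gamma> \<in> cones C"
  shows "transport_cone C Gm Fo (\<tau> \<gamma>) = \<gamma>"
proof -
  obtain z where "\<gamma> \<in> (\<Pi>\<^sub>E c \<in> Obj C. Mor C c z)"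
    using assms by (auto simp: cones_def cone_with_vertex_def)
  then show ?thesis
    by (intro ext) (auto simp: transport_cone_def Fo_Obj Go_Fo Gm_Fm Mor_def PiE_iff extensional_def)
qed

end

section \<open>Transport of the semigroup of cones\<close>

text \<open>Guarantees that the products in \<open>cone_star\<close> are composable, without which
  functoriality could not be applied to them.\<close>

lemma (in normal_category) epi_part_Mor:
  assumes "f \<in> Mor C a b"
  obtains v where "epi_part C f \<in> Mor C a v"
proof -
  obtain q u j where nf: "normal_factorisation C f q u j"
    using has_normal_factorisation[of f] assms by (auto simp: Mor_def)
  then obtain a' b' v w where 1: "q \<in> Mor C a' w" "u \<in> Mor C w v" "j \<in> Mor C v b'" "f = q \<cdot> u \<cdot> j"
    by (rule normal_factorisationE)
  have qu: "q \<cdot> u \<in> Mor C a' v" using 1 by (auto intro: Comp_closed)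
  have "f \<in> Mor C a' b'" unfolding 1(4) by (rule Comp_closed[OF qu 1(3)])
  then have "a' = a" using assms by (simp add: Mor_def)
  then show ?thesis using that qu epi_part_eqI[OF nf] by simp
qed

lemma cone_vertex_Obj: "cone_with_vertex C z \<gamma> \<Longrightarrow> z \<in> Obj C"
  and cone_Mor: "cone_with_vertex C z \<gamma> \<Longrightarrow> c \<in> Obj C \<Longrightarrow> \<gamma> c \<in> Mor C c z"
  by (auto simp: cone_with_vertex_def)

lemma (in category_with_subobjects) cones_vertex:
  "\<gamma> \<in> cones C \<Longrightarrow> cone_with_vertex C (vertex C \<gamma>) \<gamma>"
  using vertex_eqI by (auto simp: cones_def)

lemma carrier_cone_semigroup: "carrier (cone_semigroup C) = cones C"
  by (simp add: cone_semigroup_def)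

lemma mult_cone_semigroup:
  "\<gamma> \<otimes>\<^bsub>cone_semigroup C\<^esub> \<delta> = cone_star C \<gamma> (epi_part C (\<delta> (vertex C \<gamma>)))"
  by (simp add: cone_semigroup_def)

lemma down_set_R_classes: "down_set C (R_classes (cone_semigroup C))"
  by (simp add: down_set_def)

lemma connecting_cone_eqI:
  assumes "inj_on (vertex C) (idempotents (cone_semigroup C))"
    and "\<epsilon> \<in> d" "\<epsilon> \<in> idempotents (cone_semigroup C)" "vertex C \<epsilon> = c"
  shows "connecting_cone C c d = \<epsilon>"
  unfolding connecting_cone_def using assms by (intro the_equality) (auto dest: inj_onD)

lemma CC_isomorphic_sym:
  assumes "CC_isomorphic C D C' D'"
  shows "CC_isomorphic C' D' C D"
proof -
  obtain Fo Fm G Fo' Fm' G' where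
    "CC_morphism C D C' D' Fo Fm G" "CC_morphism C' D' C D Fo' Fm' G'"
    "\<forall>c \<in> Obj C. Fo' (Fo c) = c" "\<forall>c \<in> Obj C'. Fo (Fo' c) = c"
    "\<forall>f \<in> Arr C. Fm' (Fm f) = f" "\<forall>f \<in> Arr C'. Fm (Fm' f) = f"
    "\<forall>d \<in> D. G' (G d) = d" "\<forall>d \<in> D'. G (G' d) = d"
    using assms unfolding CC_isomorphic_def by (elim exE conjE)
  then show ?thesis
    unfolding CC_isomorphic_def
    by (intro exI[of _ Fo'] exI[of _ Fm'] exI[of _ G'] exI[of _ Fo] exI[of _ Fm] exI[of _ G] conjI)
qed

lemma isomorphic_self_supported_sym:
  "isomorphic_self_supported C D C' D' \<Longrightarrow> isomorphic_self_supported C' D' C D"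
  by (simp add: isomorphic_self_supported_def CC_isomorphic_sym)

locale normal_category_iso = normal_category C + subobject_category_iso C C' Fo Fm Go Gm
  for C :: "('o, 'm, 'x) subobject_category_scheme"
    and C' :: "('p, 'n, 'y) subobject_category_scheme"
    and Fo Fm Go Gm
begin

lemma target_normal: "normal_category C'"
proof (intro normal_category.intro normal_category_axioms.intro target_with_subobjects)
  show "\<exists>q. retraction_of C' j q" if j: "j \<in> Incl C'" for j
    using inclusion_splits[OF Gm_Incl[OF j]] retraction_of_Fm j target_Incl_subset Fm_Gm
    by (metis subset_iff)
  show "\<exists>q u j. normal_factorisation C' f q u j" if f: "f \<in> Arr C'" for f
    using has_normal_factorisation[OF Gm_Arr[OF f]] normal_factorisation_Fm Fm_Gm[OF f] by metis
  show "\<exists>\<mu>. cone_with_vertex C' c \<mu> \<and> \<mu> c = Ide C' c" if c: "c \<in> Obj C'" for c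
  proof -
    obtain \<mu> where "cone_with_vertex C (Go c) \<mu>" "\<mu> (Go c) = Ide C (Go c)"
      using has_cone[OF Go_Obj[OF c]] by blast
    then have "cone_with_vertex C' c (\<tau> \<mu>)" "\<tau> \<mu> c = Ide C' c"
      using cone_transport[of "Go c" \<mu>] Fm_Ide[OF Go_Obj[OF c]] c
      by (simp_all add: Fo_Go transport_cone_def)
    then show ?thesis by blast
  qed
qed

lemma inverse_normal: "normal_category_iso C' C Go Gm Fo Fm"
  by (intro normal_category_iso.intro target_normal inverse_subobject)

lemma epi_part_Fm:
  assumes "f \<in> Arr C"
  shows "epi_part C' (Fm f) = Fm (epi_part C f)"
proof -
  obtain q u j where nf: "normal_factorisation C f q u j"
    using has_normal_factorisation[OF assms] by blast
  show ?thesis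
    using normal_factorisation_Fm[OF nf] epi_part_eqI[OF nf]
      category_with_subobjects.epi_part_eqI[OF target_with_subobjects] by metis
qed

text \<open>The product of cones is built from vertices, epimorphic parts and composition, each of
  which commutes with transport; the inverse bijection is transport along the inverse
  isomorphism.\<close>

lemma transport_iso: "\<tau> \<in> iso (cone_semigroup C) (cone_semigroup C')"
proof -
  have "\<tau> (\<gamma> \<otimes>\<^bsub>cone_semigroup C\<^esub> \<delta>) = \<tau> \<gamma> \<otimes>\<^bsub>cone_semigroup C'\<^esub> \<tau> \<delta>"
    if \<gamma>: "\<gamma> \<in> cones C" and \<delta>: "\<delta> \<in> cones C" for \<gamma> \<delta>
  proof -
    let ?z = "vertex C \<gamma>" let ?e = "epi_part C (\<delta> ?z)"
    have z: "?z \<in> Obj C" by (rule cone_vertex_Obj[OF cones_vertex[OF \<gamma>]])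
    have \<delta>z: "\<delta> ?z \<in> Mor C ?z (vertex C \<delta>)" using cone_Mor[OF cones_vertex[OF \<delta>] z] .
    then obtain v where e: "?e \<in> Mor C ?z v" by (rule epi_part_Mor)
    have "Fm (\<gamma> (Go c) \<cdot>\<^bsub>C\<^esub> ?e) = Fm (\<gamma> (Go c)) \<cdot>\<^bsub>C'\<^esub> Fm ?e" if "c \<in> Obj C'" for c
      using Fm_Comp_Mor[OF cone_Mor[OF cones_vertex[OF \<gamma>] Go_Obj[OF that]] e] .
    moreover have "epi_part C' (\<tau> \<delta> (vertex C' (\<tau> \<gamma>))) = Fm ?e"
      using \<delta>z z unfolding vertex_transport[OF \<gamma>]
      by (simp add: transport_cone_def Fo_Obj Go_Fo epi_part_Fm Mor_def)
    ultimately show ?thesis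
      unfolding mult_cone_semigroup
      by (auto simp: cone_star_def transport_cone_def Go_Obj)
  qed
  moreover have "bij_betw \<tau> (cones C) (cones C')"
    using transport_cones transport_inverse
      subobject_category_iso.transport_cones[OF inverse_subobject]
      subobject_category_iso.transport_inverse[OF inverse_subobject]
    by (intro bij_betwI[where g = "transport_cone C Gm Fo"]) auto
  ultimately show ?thesis
    unfolding iso_def hom_def carrier_cone_semigroup using transport_cones by blast
qed

end

section \<open>Transport of connectedness, CC-morphisms and self-support\<close>

text \<open>Both extra assumptions concern the source only. Injectivity of \<open>vertex\<close> on
  all idempotents is stronger than uniqueness within one class, and it makes the \<open>THE\<close>
  in \<open>connecting_cone\<close> determinate.\<close>

locale cone_semigroup_iso = normal_category_iso C C' Fo Fm Go Gm
  for C :: "('o, 'm, 'x) subobject_category_scheme"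
    and C' :: "('p, 'n, 'y) subobject_category_scheme"
    and Fo Fm Go Gm +
  assumes cone_mult_closed:
      "\<gamma> \<in> cones C \<Longrightarrow> \<delta> \<in> cones C \<Longrightarrow> \<gamma> \<otimes>\<^bsub>cone_semigroup C\<^esub> \<delta> \<in> cones C"
    and idempotent_vertex_inj: "inj_on (vertex C) (idempotents (cone_semigroup C))"
begin

abbreviation S where "S \<equiv> cone_semigroup C"
abbreviation T where "T \<equiv> cone_semigroup C'"

sublocale sg: semigroup_iso S T \<tau>
  by unfold_locales (simp_all add: transport_iso carrier_cone_semigroup cone_mult_closed)

lemma Fo_eq_iff: "a \<in> Obj C \<Longrightarrow> b \<in> Obj C \<Longrightarrow> Fo a = Fo b \<longleftrightarrow> a = b"
  by (metis Go_Fo)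

lemma R_class_cones: "d \<in> R_classes S \<Longrightarrow> d \<subseteq> cones C"
  using sg.R_class_closed by (simp add: carrier_cone_semigroup)

lemma idempotent_transport_iff: "\<gamma> \<in> cones C \<Longrightarrow> \<tau> \<gamma> \<in> idempotents T \<longleftrightarrow> \<gamma> \<in> idempotents S"
  using sg.idempotent_iff by (simp add: carrier_cone_semigroup)

lemma vertex_transport_iff:
  "\<gamma> \<in> cones C \<Longrightarrow> c \<in> Obj C \<Longrightarrow> vertex C' (\<tau> \<gamma>) = Fo c \<longleftrightarrow> vertex C \<gamma> = c"
  using cone_vertex_Obj[OF cones_vertex] by (simp add: vertex_transport Fo_eq_iff)

lemma target_idempotent_vertex_inj: "inj_on (vertex C') (idempotents T)"
proof (rule inj_onI)
  fix x y assume x: "x \<in> idempotents T" and y: "y \<in> idempotents T" and eq: "vertex C' x = vertex C' y"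
  have "x \<in> \<tau> ` cones C" "y \<in> \<tau> ` cones C"
    using x y sg.image by (auto simp: idempotents_def carrier_cone_semigroup)
  then obtain \<gamma> \<delta> where *: "\<gamma> \<in> cones C" "x = \<tau> \<gamma>" "\<delta> \<in> cones C" "y = \<tau> \<delta>" by blast
  then have "vertex C \<gamma> = vertex C \<delta>"
    using eq vertex_transport_iff[OF *(1) cone_vertex_Obj[OF cones_vertex[OF *(3)]]]
    by (simp add: vertex_transport)
  then show "x = y"
    using * x y idempotent_vertex_inj by (auto simp: idempotent_transport_iff dest: inj_onD)
qed

text \<open>The two assumptions on cones pass to \<open>C'\<close> through \<open>\<tau>\<close>, so
  source and target may be interchanged at this level as well.\<close>

lemma inverse_cone_semigroup: "cone_semigroup_iso C' C Go Gm Fo Fm"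
  by (intro cone_semigroup_iso.intro cone_semigroup_iso_axioms.intro inverse_normal
      target_idempotent_vertex_inj sg.target_mult_closed[unfolded carrier_cone_semigroup])

lemma connected_by_iff:
  assumes "d \<in> R_classes S" "c \<in> Obj C"
  shows "connected_by C' (Fo c) (\<tau> ` d) \<longleftrightarrow> connected_by C c d"
proof -
  have "\<tau> \<epsilon> \<in> idempotents T \<and> vertex C' (\<tau> \<epsilon>) = Fo c \<longleftrightarrow> \<epsilon> \<in> idempotents S \<and> vertex C \<epsilon> = c"
    if "\<epsilon> \<in> d" for \<epsilon>
    using R_class_cones[OF assms(1)] that assms(2) idempotent_transport_iff[of \<epsilon>]
      vertex_transport_iff[of \<epsilon> c] by blast
  then show ?thesis by (simp add: connected_by_def)
qed

lemma connecting_cone_transport: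
  assumes "d \<in> R_classes S" "c \<in> Obj C" "connected_by C c d"
  shows "connecting_cone C' (Fo c) (\<tau> ` d) = \<tau> (connecting_cone C c d)"
proof -
  \<comment> \<open>Any idempotent witnessing the connection is the connecting cone, and its
    transport has the defining properties on the other side.\<close>
  obtain \<epsilon> where *: "\<epsilon> \<in> d" "\<epsilon> \<in> idempotents S" "vertex C \<epsilon> = c"
    using assms(3) by (auto simp: connected_by_def)
  then have "\<epsilon> \<in> cones C" using R_class_cones[OF assms(1)] by blast
  then have "connecting_cone C' (Fo c) (\<tau> ` d) = \<tau> \<epsilon>"
    using * assms(2) by (intro connecting_cone_eqI target_idempotent_vertex_inj)
      (auto simp: idempotent_transport_iff vertex_transport_iff)
  then show ?thesis using connecting_cone_eqI[OF idempotent_vertex_inj *] by simp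
qed

lemma connected_category_target:
  assumes "connected_category C (R_classes S)"
  shows "connected_category C' (R_classes T)"
  unfolding connected_category_def
proof (intro conjI target_normal down_set_R_classes ballI)
  fix c assume c: "c \<in> Obj C'"
  then obtain d where "d \<in> R_classes S" "connected_by C (Go c) d"
    using assms Go_Obj by (auto simp: connected_category_def)
  then show "\<exists>d \<in> R_classes T. connected_by C' c d"
    using connected_by_iff[of d "Go c"] c by (auto simp: sg.R_classes_image Go_Obj Fo_Go)
qed

lemma CC_morphism_transport:
  assumes "connected_category C (R_classes S)"
  shows "CC_morphism C (R_classes S) C' (R_classes T) Fo Fm ((`) \<tau>)"
  unfolding CC_morphism_def
proof (intro conjI ballI impI assms connected_category_target)
  show "category_functor C C' Fo Fm"
    by (intro category_functor.intro category_functor_axioms.intro target_category category_axioms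
        Fo_Obj Fm_Mor Fm_Ide Fm_Comp_Mor)
  show "(`) \<tau> \<in> R_classes S \<rightarrow> R_classes T" by (auto simp: sg.R_classes_image)
  \<comment> \<open>The right-hand side is the transported connecting cone evaluated at
    \<open>Fo c'\<close>; since \<open>Go (Fo c') = c'\<close>, this is \<open>Fm\<close> of the
    original component.\<close>
  show "Fm (connecting_cone C c d c') = connecting_cone C' (Fo c) (\<tau> ` d) (Fo c')"
    if "c \<in> Obj C" "d \<in> R_classes S" "connected_by C c d" "c' \<in> Obj C" for c d c'
    using that(1,4)
    by (simp add: connecting_cone_transport[OF that(2,1,3)])
      (simp add: transport_cone_def Fo_Obj Go_Fo)
  show "R_le T (\<tau> ` d) (\<tau> ` e)" if "d \<in> R_classes S" "e \<in> R_classes S" "R_le S d e" for d e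
    using that by (simp add: sg.R_le_image_iff)
  show "connected_by C' (Fo c) (\<tau> ` d)" if "c \<in> Obj C" "d \<in> R_classes S" "connected_by C c d" for c d
    using that by (simp add: connected_by_iff)
qed (rule Fm_Incl)

lemma image_transport_inverse:
  assumes "d \<in> R_classes S"
  shows "transport_cone C Gm Fo ` \<tau> ` d = d"
proof -
  have "transport_cone C Gm Fo (\<tau> \<gamma>) = \<gamma>" if "\<gamma> \<in> d" for \<gamma>
    using R_class_cones[OF assms] that transport_inverse by blast
  then show ?thesis by (simp add: image_image)
qed

lemma CC_isomorphic_target:
  assumes "connected_category C (R_classes S)"
  shows "CC_isomorphic C (R_classes S) C' (R_classes T)"
proof -
  \<comment> \<open>With the roles interchanged, the result on the forward CC-morphism also delivers
    the backward one.\<close>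
  interpret inv: cone_semigroup_iso C' C Go Gm Fo Fm by (rule inverse_cone_semigroup)
  show ?thesis
    unfolding CC_isomorphic_def
    using CC_morphism_transport[OF assms] inv.CC_morphism_transport[OF connected_category_target[OF assms]]
    by (intro exI[of _ Fo] exI[of _ Fm] exI[of _ "(`) \<tau>"] exI[of _ Go] exI[of _ Gm]
        exI[of _ "(`) (transport_cone C Gm Fo)"])
      (simp add: Go_Fo Fo_Go Gm_Fm Fm_Gm image_transport_inverse inv.image_transport_inverse)
qed

text \<open>The support map of \<open>C'\<close> turns out to be \<open>Go\<close>, followed by the
  support map of \<open>C\<close>, followed by taking images under \<open>\<tau>\<close>. All three
  are bijections and compatible with the orders.\<close>

lemma self_supported_target:
  assumes "self_supported_category C (R_classes S)"
  shows "self_supported_category C' (R_classes T)"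
proof -
  let ?D = "R_classes S" and ?D' = "R_classes T"
  have C: "connected_category C ?D" and ex1: "\<And>c. c \<in> Obj C \<Longrightarrow> \<exists>!d. d \<in> ?D \<and> connected_by C c d"
    and bij: "bij_betw (support_map C ?D) (Obj C) ?D"
    and le: "\<And>a b. a \<in> Obj C \<Longrightarrow> b \<in> Obj C \<Longrightarrow>
      subobject C a b \<longleftrightarrow> R_le S (support_map C ?D a) (support_map C ?D b)"
    using assms by (simp_all add: self_supported_category_def supported_category_def)
  have bij_image: "bij_betw ((`) \<tau>) ?D ?D'"
    unfolding bij_betw_def sg.R_classes_image
    by (intro conjI refl inj_on_inverseI[where g = "(`) (transport_cone C Gm Fo)"]
        image_transport_inverse)
  have support: "support_map C ?D c \<in> ?D" "connected_by C c (support_map C ?D c)" if "c \<in> Obj C" for c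
    unfolding support_map_def using theI'[OF ex1[OF that]] by auto
  have unique': "d' = \<tau> ` support_map C ?D (Go c)"
    if c: "c \<in> Obj C'" and d': "d' \<in> ?D'" "connected_by C' c d'" for c d'
  proof -
    obtain d where d: "d \<in> ?D" "d' = \<tau> ` d" using d'(1) by (auto simp: sg.R_classes_image)
    then have "connected_by C (Go c) d"
      using d'(2) connected_by_iff[of d "Go c"] c by (simp add: Go_Obj Fo_Go)
    then show ?thesis using d ex1[OF Go_Obj[OF c]] support[OF Go_Obj[OF c]] by blast
  qed
  have support': "\<tau> ` support_map C ?D (Go c) \<in> ?D'" "connected_by C' c (\<tau> ` support_map C ?D (Go c))"
    if "c \<in> Obj C'" for c
    using support[OF Go_Obj[OF that]] connected_by_iff[OF support(1)[OF Go_Obj[OF that]] Go_Obj[OF that]] that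
    by (auto simp: sg.R_classes_image Fo_Go)
  have map': "support_map C' ?D' c = \<tau> ` support_map C ?D (Go c)" if "c \<in> Obj C'" for c
    unfolding support_map_def[of C']
    by (rule the_equality) (use unique'[OF that] support'[OF that] in blast)+
  have "bij_betw Go (Obj C') (Obj C)"
    by (rule bij_betwI[where g = Fo]) (auto simp: Go_Obj Fo_Obj Fo_Go Go_Fo)
  then have "bij_betw ((`) \<tau> \<circ> (support_map C ?D \<circ> Go)) (Obj C') ?D'"
    using bij bij_image by (blast intro: bij_betw_trans)
  then have "bij_betw (support_map C' ?D') (Obj C') ?D'"
    using map' by (simp cong: bij_betw_cong)
  moreover have "subobject C' a b \<longleftrightarrow> R_le T (support_map C' ?D' a) (support_map C' ?D' b)"
    if "a \<in> Obj C'" "b \<in> Obj C'" for a b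
    using that subobject_Fo_iff[of "Go a" "Go b"] le[of "Go a" "Go b"]
    by (simp add: map' Go_Obj Fo_Go sg.R_le_image_iff support(1))
  moreover have "\<exists>!d. d \<in> ?D' \<and> connected_by C' c d" if "c \<in> Obj C'" for c
    using unique'[OF that] support'[OF that] by blast
  ultimately show ?thesis
    using connected_category_target[OF C]
    by (simp add: self_supported_category_def supported_category_def)
qed

lemma isomorphic_self_supported_target:
  assumes "self_supported_category C (R_classes S)"
  shows "isomorphic_self_supported C (R_classes S) C' (R_classes T)"
  unfolding isomorphic_self_supported_def
proof (intro conjI assms self_supported_target CC_isomorphic_target)
  show "connected_category C (R_classes S)"
    using assms by (simp add: self_supported_category_def supported_category_def)
qed

end

section \<open>Partial bijections\<close>

lemma dom_Some_restrict [simp]: "dom (Some |` A) = A"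
  by (auto simp: restrict_map_def dom_def)

lemma ran_Some_restrict [simp]: "ran (Some |` A) = A"
  by (auto simp: restrict_map_def ran_def)

lemma map_comp_Some_restrict: "f \<circ>\<^sub>m (Some |` A) = f |` A"
  by (auto simp: map_comp_def restrict_map_def)

lemma Some_restrict_comp: "ran f \<subseteq> B \<Longrightarrow> (Some |` B) \<circ>\<^sub>m f = f"
  by (rule ext) (auto simp: map_comp_def restrict_map_def ran_def split: option.split)

lemma restrict_map_dom:
  assumes "dom f \<subseteq> A"
  shows "f |` A = f"
proof
  show "(f |` A) x = f x" for x using assms by (cases "f x") (auto simp: restrict_map_def)
qed

lemma map_comp_assoc: "(h \<circ>\<^sub>m g) \<circ>\<^sub>m f = h \<circ>\<^sub>m (g \<circ>\<^sub>m f)"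
  by (rule ext) (simp add: map_comp_def split: option.split)

lemma map_comp_restrict: "(g \<circ>\<^sub>m f) |` A = g \<circ>\<^sub>m (f |` A)"
  by (rule ext) (simp add: map_comp_def restrict_map_def)

lemma map_comp_restrict_ran: "ran f \<subseteq> B \<Longrightarrow> (g |` B) \<circ>\<^sub>m f = g \<circ>\<^sub>m f"
  by (rule ext) (auto simp: map_comp_def restrict_map_def ran_def split: option.split)

lemma ran_map_comp: "ran (g \<circ>\<^sub>m f) = ran (g |` ran f)"
  by (fastforce simp: map_comp_def restrict_map_def ran_def split: option.splits if_splits)

lemma dom_map_comp_subset: "dom (g \<circ>\<^sub>m f) \<subseteq> dom f"
  by (auto simp: map_comp_def dom_def split: option.splits)

lemma partial_bijections_iff:
  "f \<in> partial_bijections A B \<longleftrightarrow>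
     dom f \<subseteq> A \<and> ran f \<subseteq> B \<and> (\<forall>x x' y. f x = Some y \<longrightarrow> f x' = Some y \<longrightarrow> x = x')"
  unfolding partial_bijections_def inj_on_def dom_def by auto

lemma partial_bijections_unit:
  assumes "f \<in> partial_bijections A B"
  shows "f |` A = f" "(Some |` B) \<circ>\<^sub>m f = f"
  using assms by (auto simp: partial_bijections_def restrict_map_dom Some_restrict_comp)

lemma Some_restrict_partial_bijection:
  "C \<subseteq> A \<Longrightarrow> C \<subseteq> B \<Longrightarrow> Some |` C \<in> partial_bijections A B"
  by (auto simp: partial_bijections_iff restrict_map_def ran_def split: if_splits)

lemma partial_bijections_mono:
  "f \<in> partial_bijections A B \<Longrightarrow> A \<subseteq> A' \<Longrightarrow> B \<subseteq> B' \<Longrightarrow> f \<in> partial_bijections A' B'"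
  by (auto simp: partial_bijections_def)

lemma partial_bijections_image:
  "f \<in> partial_bijections A B \<Longrightarrow> f \<in> partial_bijections A (ran f)"
  "f \<in> partial_bijections A B \<Longrightarrow> f \<in> partial_bijections (dom f) (ran f)"
  by (auto simp: partial_bijections_def)

lemma partial_bijections_restrict:
  "f \<in> partial_bijections A B \<Longrightarrow> f |` C \<in> partial_bijections C B"
  by (auto simp: partial_bijections_iff restrict_map_def ran_def split: if_splits)

lemma partial_bijections_comp:
  assumes f: "f \<in> partial_bijections A B" and g: "g \<in> partial_bijections B C"
  shows "g \<circ>\<^sub>m f \<in> partial_bijections A C"
  unfolding partial_bijections_iff
proof (intro conjI allI impI)
  show "dom (g \<circ>\<^sub>m f) \<subseteq> A"
    using dom_map_comp_subset[of g f] f unfolding partial_bijections_def by blast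
  show "ran (g \<circ>\<^sub>m f) \<subseteq> C"
    using g unfolding ran_map_comp
    by (auto simp: partial_bijections_def ran_def restrict_map_def split: if_splits)
  fix x x' z assume "(g \<circ>\<^sub>m f) x = Some z" "(g \<circ>\<^sub>m f) x' = Some z"
  then obtain y y' where "f x = Some y" "g y = Some z" "f x' = Some y'" "g y' = Some z"
    by (auto simp: map_comp_Some_iff)
  then show "x = x'" using f g unfolding partial_bijections_iff by metis
qed

lemma partial_bijection_inverse:
  assumes "f \<in> partial_bijections A B"
  obtains g where "g \<in> partial_bijections (ran f) (dom f)"
    "g \<circ>\<^sub>m f = Some |` dom f" "f \<circ>\<^sub>m g = Some |` ran f"
proof
  define g where "g = (\<lambda>y. if y \<in> ran f then Some (SOME x. f x = Some y) else None)"
  have inj: "x = x'" if "f x = Some y" "f x' = Some y" for x x' y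
    using assms that by (auto simp: partial_bijections_iff)
  \<comment> \<open>The graph of \<open>g\<close> is the converse of that of \<open>f\<close>; the
    remaining claims are read off from this.\<close>
  have g: "g y = Some x \<longleftrightarrow> f x = Some y" for x y
    using inj by (auto simp: g_def ran_def intro: someI some_equality)
  show "g \<in> partial_bijections (ran f) (dom f)"
    by (auto simp: partial_bijections_iff g ran_def)
  show "g \<circ>\<^sub>m f = Some |` dom f"
    by (rule ext) (auto simp: map_comp_def restrict_map_def g split: option.split)
  show "f \<circ>\<^sub>m g = Some |` ran f"
    by (rule ext) (auto simp: map_comp_def restrict_map_def g ran_def split: option.split
        dest: g[THEN iffD2])
qed

section \<open>The category of subsets\<close>

lemma subset_category_simps [simp]:
  "Obj (subset_category X) = Pow X"
  "F \<in> Arr (subset_category X) \<longleftrightarrow>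
     (\<exists>A f B. F = (A, f, B) \<and> A \<subseteq> X \<and> B \<subseteq> X \<and> f \<in> partial_bijections A B)"
  "Dom (subset_category X) (A, f, B) = A"
  "Cod (subset_category X) (A, f, B) = B"
  "Ide (subset_category X) A = (A, Some |` A, A)"
  "Comp (subset_category X) (A, f, B) (B', g, D) = (A, g \<circ>\<^sub>m f, D)"
  "F \<in> Incl (subset_category X) \<longleftrightarrow> (\<exists>A B. F = (A, Some |` A, B) \<and> A \<subseteq> B \<and> B \<subseteq> X)"
  by (auto simp: subset_category_def)

lemma Mor_subset_category:
  "F \<in> Mor (subset_category X) A B \<longleftrightarrow>
     (\<exists>f. F = (A, f, B) \<and> A \<subseteq> X \<and> B \<subseteq> X \<and> f \<in> partial_bijections A B)"
  by (auto simp: Mor_def)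

lemma Mor_inclusions_subset_category:
  "F \<in> Mor (inclusions (subset_category X)) A B \<longleftrightarrow> F = (A, Some |` A, B) \<and> A \<subseteq> B \<and> B \<subseteq> X"
  by (auto simp: Mor_def)

lemma category_subset_category: "category (subset_category X)"
proof
  fix F G H A B C D
  assume F: "F \<in> Mor (subset_category X) A B"
  then show "Ide (subset_category X) A \<cdot>\<^bsub>subset_category X\<^esub> F = F"
    "F \<cdot>\<^bsub>subset_category X\<^esub> Ide (subset_category X) B = F"
    by (auto simp: Mor_subset_category map_comp_Some_restrict Some_restrict_comp restrict_map_dom
        partial_bijections_def)
  assume G: "G \<in> Mor (subset_category X) B C"
  then show "F \<cdot>\<^bsub>subset_category X\<^esub> G \<in> Mor (subset_category X) A C"
    using F by (auto simp: Mor_subset_category partial_bijections_comp)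
  assume "H \<in> Mor (subset_category X) C D"
  then show "F \<cdot>\<^bsub>subset_category X\<^esub> G \<cdot>\<^bsub>subset_category X\<^esub> H =
      F \<cdot>\<^bsub>subset_category X\<^esub> (G \<cdot>\<^bsub>subset_category X\<^esub> H)"
    using F G by (auto simp: Mor_subset_category map_comp_assoc)
qed (auto simp: Mor_subset_category Some_restrict_partial_bijection)

text \<open>If \<open>g\<close> inverts \<open>f\<close>, then \<open>f\<close> followed by
  \<open>g\<close> is defined on all of \<open>A\<close>, and \<open>g\<close> followed by
  \<open>f\<close> reaches all of \<open>B\<close>. Conversely the inverse partial bijection serves
  as inverse arrow.\<close>

lemma isomorphism_subset_category:
  assumes "A \<subseteq> X" "B \<subseteq> X" "f \<in> partial_bijections A B"
  shows "isomorphism (subset_category X) (A, f, B) \<longleftrightarrow> dom f = A \<and> ran f = B"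
proof
  assume "isomorphism (subset_category X) (A, f, B)"
  then obtain g where g: "g \<circ>\<^sub>m f = Some |` A" "f \<circ>\<^sub>m g = Some |` B"
    by (auto simp: isomorphism_def Mor_subset_category)
  have "A \<subseteq> dom f" using dom_map_comp_subset[of g f] g by simp
  moreover have "B \<subseteq> ran f"
    using ran_map_comp[of f g] g by (auto simp: ran_def restrict_map_def split: if_splits)
  ultimately show "dom f = A \<and> ran f = B" using assms by (auto simp: partial_bijections_def)
next
  assume *: "dom f = A \<and> ran f = B"
  obtain g where "g \<in> partial_bijections B A" "g \<circ>\<^sub>m f = Some |` A" "f \<circ>\<^sub>m g = Some |` B"
    using partial_bijection_inverse[OF assms(3)] * by metis
  then show "isomorphism (subset_category X) (A, f, B)"
    using assms
    by (auto simp: isomorphism_def Mor_subset_category intro!: bexI[of _ "(B, g, A)"])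
qed

lemma strict_preorder_subset_inclusions: "strict_preorder (inclusions (subset_category X))"
proof
  fix F assume "isomorphism (inclusions (subset_category X)) F"
  then show "F = Ide (inclusions (subset_category X)) (Dom (inclusions (subset_category X)) F)"
    by (auto simp: isomorphism_def Mor_inclusions_subset_category)
qed (auto simp: Mor_inclusions_subset_category map_comp_Some_restrict Int_absorb1)

lemma category_with_subobjects_subset_category: "category_with_subobjects (subset_category X)"
proof (intro category_with_subobjects.intro category_with_subobjects_axioms.intro
    category_subset_category strict_preorder_subset_inclusions)
  show "Incl (subset_category X) \<subseteq> Arr (subset_category X)"
    by (auto simp: Some_restrict_partial_bijection) blast
  show "monomorphism (subset_category X) F" if F: "F \<in> Incl (subset_category X)" for F
  proof -
    obtain A B where AB: "F = (A, Some |` A, B)" "A \<subseteq> B" "B \<subseteq> X" using F by auto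
    then have "A \<subseteq> X" "Some |` A \<in> partial_bijections A B"
      by (auto simp: Some_restrict_partial_bijection)
    \<comment> \<open>Following a map by an inclusion changes only its recorded codomain, so the
      inclusion can be cancelled.\<close>
    then show ?thesis
      using AB by (auto simp: monomorphism_def Mor_subset_category partial_bijections_unit)
  qed
  fix F G H
  assume *: "F \<in> Incl (subset_category X)" "G \<in> Incl (subset_category X)" "H \<in> Arr (subset_category X)"
    "Cod (subset_category X) H = Dom (subset_category X) G" "F = H \<cdot>\<^bsub>subset_category X\<^esub> G"
  then obtain A h B where H: "H = (A, h, B)" "B \<subseteq> X" "h \<in> partial_bijections A B" by auto
  \<comment> \<open>For the same reason \<open>h\<close> is the underlying map of \<open>F\<close>,
    a partial identity.\<close>
  then have h: "h = Some |` A" using * by (auto simp: partial_bijections_def Some_restrict_comp)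
  then have "A \<subseteq> B" using H(3) unfolding partial_bijections_def by simp
  then show "H \<in> Incl (subset_category X)" using H h by simp
qed

lemma subobject_subset_category:
  "subobject (subset_category X) A B \<longleftrightarrow> A \<subseteq> B \<and> B \<subseteq> X"
  by (auto simp: subobject_def Mor_inclusions_subset_category)

lemma inclusion_subset_category:
  "A \<subseteq> B \<Longrightarrow> B \<subseteq> X \<Longrightarrow> inclusion (subset_category X) A B = (A, Some |` A, B)"
  by (simp add: inclusion_def Mor_inclusions_subset_category)

text \<open>Partiality provides the retraction: the identity on \<open>A\<close>, left undefined on
  the rest of \<open>B\<close>.\<close>

lemma retraction_of_subset_category:
  "A \<subseteq> B \<Longrightarrow> B \<subseteq> X \<Longrightarrow>
     retraction_of (subset_category X) (A, Some |` A, B) (B, Some |` A, A)"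
  by (auto simp: retraction_of_def Mor_subset_category Some_restrict_partial_bijection
      Some_restrict_comp)

text \<open>The retraction discards the points where \<open>f\<close> is undefined and the inclusion
  supplies those of \<open>B\<close> outside the image, so the middle arrow is total and onto, hence
  invertible.\<close>

lemma normal_factorisation_subset_category:
  assumes "A \<subseteq> X" "B \<subseteq> X" "f \<in> partial_bijections A B"
  shows "normal_factorisation (subset_category X) (A, f, B)
    (A, Some |` dom f, dom f) (dom f, f, ran f) (ran f, Some |` ran f, B)"
proof -
  have *: "dom f \<subseteq> A" "ran f \<subseteq> B" using assms(3) by (auto simp: partial_bijections_def)
  have "retraction (subset_category X) (A, Some |` dom f, dom f)"
    using retraction_of_subset_category[OF *(1) assms(1)] by (auto simp: retraction_def)
  moreover have "isomorphism (subset_category X) (dom f, f, ran f)"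
    using * assms partial_bijections_image(2)[OF assms(3)] by (subst isomorphism_subset_category) auto
  ultimately show ?thesis
    using * assms
    by (simp add: normal_factorisation_def map_comp_Some_restrict restrict_map_dom Some_restrict_comp)
qed

lemma epi_part_subset_category:
  assumes "A \<subseteq> X" "B \<subseteq> X" "f \<in> partial_bijections A B"
  shows "epi_part (subset_category X) (A, f, B) = (A, f, ran f)"
  using category_with_subobjects.epi_part_eqI[OF category_with_subobjects_subset_category
      normal_factorisation_subset_category[OF assms]]
  by (simp add: map_comp_Some_restrict restrict_map_dom)

section \<open>Cones over the subsets and their partial bijections\<close>

text \<open>The common codomain is \<open>ran f\<close> and not \<open>X\<close>, so that the
  component at \<open>dom f\<close> is invertible, as a cone requires.\<close>

definition subset_cone :: "'a set \<Rightarrow> ('a \<rightharpoonup> 'a) \<Rightarrow> 'a set \<Rightarrow> 'a set \<times> ('a \<rightharpoonup> 'a) \<times> 'a set" where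
  "subset_cone X f = (\<lambda>A \<in> Pow X. (A, f |` A, ran f))"

lemma subset_cone_with_vertex:
  assumes "f \<in> partial_bijections X X"
  shows "cone_with_vertex (subset_category X) (ran f) (subset_cone X f)"
proof -
  have *: "dom f \<subseteq> X" "ran f \<subseteq> X" using assms by (auto simp: partial_bijections_def)
  have f: "f |` A \<in> partial_bijections A (ran f)" for A
    using partial_bijections_restrict[OF partial_bijections_image(1)[OF assms]] .
  have "isomorphism (subset_category X) (subset_cone X f (dom f))"
    using isomorphism_subset_category[OF * f] * by (simp add: subset_cone_def restrict_map_dom)
  then have "\<exists>A \<in> Obj (subset_category X). isomorphism (subset_category X) (subset_cone X f A)"
    using * by auto
  moreover have "inclusion (subset_category X) A B \<cdot>\<^bsub>subset_category X\<^esub> subset_cone X f B = subset_cone X f A"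
    if "A \<subseteq> B" "B \<subseteq> X" for A B
    using that
    by (simp add: inclusion_subset_category subset_cone_def map_comp_Some_restrict Int_absorb1 subset_trans)
  ultimately show ?thesis
    using * f by (auto simp: cone_with_vertex_def subobject_subset_category Mor_subset_category
        subset_cone_def)
qed

text \<open>The invertible component of a cone forces the vertex to be the image of the component at \<open>X\<close>.\<close>

lemma cone_subset_category:
  assumes "cone_with_vertex (subset_category X) Z \<gamma>"
  obtains f where "f \<in> partial_bijections X X" "\<gamma> = subset_cone X f"
proof -
  have \<gamma>: "Z \<subseteq> X" "\<And>A. A \<subseteq> X \<Longrightarrow> \<gamma> A \<in> Mor (subset_category X) A Z" "\<gamma> \<in> extensional (Pow X)"
    "\<And>A. A \<subseteq> X \<Longrightarrow> inclusion (subset_category X) A X \<cdot>\<^bsub>subset_category X\<^esub> \<gamma> X = \<gamma> A"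
    "\<exists>A. A \<subseteq> X \<and> isomorphism (subset_category X) (\<gamma> A)"
    using assms by (auto simp: cone_with_vertex_def PiE_iff subobject_subset_category)
  obtain f where f: "\<gamma> X = (X, f, Z)" "f \<in> partial_bijections X Z"
    using \<gamma>(2)[of X] by (auto simp: Mor_subset_category)
  have comp: "\<gamma> A = (A, f |` A, Z)" if "A \<subseteq> X" for A
    using \<gamma>(4)[OF that] f that by (simp add: inclusion_subset_category map_comp_Some_restrict)
  obtain A where A: "A \<subseteq> X" "isomorphism (subset_category X) (\<gamma> A)" using \<gamma>(5) by blast
  have "ran (f |` A) = Z"
    using A isomorphism_subset_category[OF A(1) \<gamma>(1) partial_bijections_restrict[OF f(2)]]
    by (simp add: comp)
  then have "ran f = Z"
    using f(2) by (auto simp: partial_bijections_def restrict_map_def ran_def split: if_splits)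
  then have "\<gamma> = subset_cone X f"
    using comp \<gamma>(3) by (intro ext) (auto simp: subset_cone_def extensional_def)
  then show ?thesis using that partial_bijections_mono[OF f(2) subset_refl \<gamma>(1)] by blast
qed

lemma cones_subset_category: "cones (subset_category X) = subset_cone X ` partial_bijections X X"
proof (intro equalityI subsetI)
  fix \<gamma> assume "\<gamma> \<in> cones (subset_category X)"
  then obtain Z where "cone_with_vertex (subset_category X) Z \<gamma>" by (auto simp: cones_def)
  then obtain f where "f \<in> partial_bijections X X" "\<gamma> = subset_cone X f"
    by (rule cone_subset_category)
  then show "\<gamma> \<in> subset_cone X ` partial_bijections X X" by blast
next
  fix \<gamma> assume "\<gamma> \<in> subset_cone X ` partial_bijections X X"
  then show "\<gamma> \<in> cones (subset_category X)"
    using subset_cone_with_vertex unfolding cones_def by blast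
qed

lemma normal_category_subset_category: "normal_category (subset_category X)"
proof (intro normal_category.intro normal_category_axioms.intro
    category_with_subobjects_subset_category)
  show "\<exists>q. retraction_of (subset_category X) j q" if j: "j \<in> Incl (subset_category X)" for j
  proof -
    obtain A B where "j = (A, Some |` A, B)" "A \<subseteq> B" "B \<subseteq> X" using j by auto
    then show ?thesis using retraction_of_subset_category by blast
  qed
  show "\<exists>q u j. normal_factorisation (subset_category X) F q u j"
    if F: "F \<in> Arr (subset_category X)" for F
  proof -
    obtain A f B where "F = (A, f, B)" "A \<subseteq> X" "B \<subseteq> X" "f \<in> partial_bijections A B"
      using F by auto
    then show ?thesis using normal_factorisation_subset_category by blast
  qed
  show "\<exists>\<mu>. cone_with_vertex (subset_category X) A \<mu> \<and> \<mu> A = Ide (subset_category X) A"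
    if "A \<in> Obj (subset_category X)" for A
    \<comment> \<open>The cone of the partial identity on \<open>A\<close>: its vertex is
      \<open>A\<close>, and restricting to \<open>A\<close> changes nothing, so its component there
      is the identity.\<close>
    using subset_cone_with_vertex[OF Some_restrict_partial_bijection, of A X] that
    by (intro exI[of _ "subset_cone X (Some |` A)"]) (simp add: subset_cone_def)
qed

lemma bounded_above_subset_category: "bounded_above (subset_category X)"
  by (auto simp: bounded_above_def subobject_subset_category)

lemma vertex_subset_cone:
  "f \<in> partial_bijections X X \<Longrightarrow> vertex (subset_category X) (subset_cone X f) = ran f"
  by (rule category_with_subobjects.vertex_eqI[OF category_with_subobjects_subset_category
        subset_cone_with_vertex])

section \<open>The symmetric inverse monoid\<close>

lemma symmetric_inverse_monoid_simps [simp]: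
  "carrier (symmetric_inverse_monoid X) = partial_bijections X X"
  "f \<otimes>\<^bsub>symmetric_inverse_monoid X\<^esub> g = g \<circ>\<^sub>m f"
  by (simp_all add: symmetric_inverse_monoid_def)

text \<open>Directed from the monoid to the cones because \<open>subset_cone\<close> is explicit; it
  is inverted where the final statement asks for the other direction.\<close>

lemma subset_cone_iso:
  "subset_cone X \<in> iso (symmetric_inverse_monoid X) (cone_semigroup (subset_category X))"
proof -
  have "inj_on (subset_cone X) (partial_bijections X X)"
  proof (rule inj_onI)
    \<comment> \<open>The component at \<open>X\<close> returns the partial bijection
      itself.\<close>
    fix f g assume "f \<in> partial_bijections X X" "g \<in> partial_bijections X X"
      "subset_cone X f = subset_cone X g"
    then show "f = g"
      by (auto simp: subset_cone_def partial_bijections_def restrict_map_dom dest!: fun_cong[of _ _ X])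
  qed
  moreover have "subset_cone X (g \<circ>\<^sub>m f) =
      subset_cone X f \<otimes>\<^bsub>cone_semigroup (subset_category X)\<^esub> subset_cone X g"
    if f: "f \<in> partial_bijections X X" and g: "g \<in> partial_bijections X X" for f g
  proof -
    have ran: "ran f \<subseteq> X" "ran g \<subseteq> X" using f g by (auto simp: partial_bijections_def)
    \<comment> \<open>The second cone is evaluated at \<open>ran f\<close>, the vertex of the first.
      Passing to the epimorphic part cuts the codomain down to the image of the composite, which is
      the vertex of the product.\<close>
    have e: "epi_part (subset_category X) (subset_cone X g (ran f)) = (ran f, g |` ran f, ran (g \<circ>\<^sub>m f))"
      using epi_part_subset_category[OF ran partial_bijections_restrict[OF partial_bijections_image(1)[OF g]]]
        ran by (simp add: subset_cone_def ran_map_comp)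
    have "(g \<circ>\<^sub>m f) |` A = (g |` ran f) \<circ>\<^sub>m (f |` A)" for A
    proof -
      have "ran (f |` A) \<subseteq> ran f" by (auto simp: ran_def restrict_map_def split: if_splits)
      then show ?thesis by (simp add: map_comp_restrict map_comp_restrict_ran)
    qed
    then show ?thesis
      by (auto simp: mult_cone_semigroup vertex_subset_cone[OF f] e cone_star_def)
        (auto simp: subset_cone_def)
  qed
  ultimately show ?thesis
    by (auto simp: iso_def hom_def bij_betw_def carrier_cone_semigroup cones_subset_category)
qed

text \<open>If \<open>dom h\<close> lies in \<open>dom f\<close>, then \<open>h\<close> is
  \<open>f\<close> followed by the inverse of \<open>f\<close> and then \<open>h\<close>, because
  \<open>f\<close> followed by its inverse is the identity on \<open>dom f\<close>. Conversely,
  multiplying on the right never enlarges a domain.\<close>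

lemma principal_right_ideal_symmetric_inverse_monoid:
  assumes f: "f \<in> partial_bijections X X"
  shows "principal_right_ideal (symmetric_inverse_monoid X) f =
    {h \<in> partial_bijections X X. dom h \<subseteq> dom f}"
proof (intro equalityI subsetI)
  show "h \<in> {h \<in> partial_bijections X X. dom h \<subseteq> dom f}"
    if h: "h \<in> principal_right_ideal (symmetric_inverse_monoid X) f" for h
  proof -
    consider "h = f" | s where "s \<in> partial_bijections X X" "h = s \<circ>\<^sub>m f"
      using h by (auto simp: principal_right_ideal_def)
    then show ?thesis by cases (use f in \<open>simp_all add: partial_bijections_comp dom_map_comp_subset\<close>)
  qed
  fix h assume "h \<in> {h \<in> partial_bijections X X. dom h \<subseteq> dom f}"
  then have h: "h \<in> partial_bijections X X" "dom h \<subseteq> dom f" by auto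
  obtain g where g: "g \<in> partial_bijections (ran f) (dom f)" "g \<circ>\<^sub>m f = Some |` dom f"
    using partial_bijection_inverse[OF f] .
  have "g \<in> partial_bijections X X"
    by (rule partial_bijections_mono[OF g(1)]) (use f in \<open>simp_all add: partial_bijections_def\<close>)
  then have "h \<circ>\<^sub>m g \<in> partial_bijections X X" using h by (simp add: partial_bijections_comp)
  moreover have "h = (h \<circ>\<^sub>m g) \<circ>\<^sub>m f"
    using h by (simp add: map_comp_assoc g map_comp_Some_restrict restrict_map_dom)
  ultimately show "h \<in> principal_right_ideal (symmetric_inverse_monoid X) f"
    by (auto simp: principal_right_ideal_def)
qed

section \<open>Green's classes and idempotents of the symmetric inverse monoid\<close>

definition dom_class :: "'a set \<Rightarrow> 'a set \<Rightarrow> ('a \<rightharpoonup> 'a) set" where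
  "dom_class X A = {f \<in> partial_bijections X X. dom f = A}"

lemma Some_restrict_dom_class: "A \<subseteq> X \<Longrightarrow> Some |` A \<in> dom_class X A"
  by (simp add: dom_class_def Some_restrict_partial_bijection)

lemma principal_right_ideal_subset_iff:
  assumes "f \<in> partial_bijections X X" "g \<in> partial_bijections X X"
  shows "principal_right_ideal (symmetric_inverse_monoid X) f \<subseteq>
    principal_right_ideal (symmetric_inverse_monoid X) g \<longleftrightarrow> dom f \<subseteq> dom g"
  unfolding principal_right_ideal_symmetric_inverse_monoid[OF assms(1)]
    principal_right_ideal_symmetric_inverse_monoid[OF assms(2)]
  using assms by blast

lemma principal_right_ideal_eq_iff:
  assumes "f \<in> partial_bijections X X" "g \<in> partial_bijections X X"
  shows "principal_right_ideal (symmetric_inverse_monoid X) f =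
    principal_right_ideal (symmetric_inverse_monoid X) g \<longleftrightarrow> dom f = dom g"
  using assms by (simp only: set_eq_subset principal_right_ideal_subset_iff)

lemma green_R_class_symmetric_inverse_monoid:
  assumes "f \<in> partial_bijections X X"
  shows "green_R (symmetric_inverse_monoid X) `` {f} = dom_class X (dom f)"
proof (rule Set.set_eqI)
  fix g
  show "g \<in> green_R (symmetric_inverse_monoid X) `` {f} \<longleftrightarrow> g \<in> dom_class X (dom f)"
    using assms principal_right_ideal_eq_iff[OF assms, of g]
    by (cases "g \<in> partial_bijections X X") (simp_all add: green_R_def dom_class_def eq_commute)
qed

lemma R_classes_symmetric_inverse_monoid:
  "R_classes (symmetric_inverse_monoid X) = dom_class X ` Pow X"
proof (intro equalityI subsetI)
  fix d assume "d \<in> R_classes (symmetric_inverse_monoid X)"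
  then obtain f where f: "f \<in> partial_bijections X X" "d = green_R (symmetric_inverse_monoid X) `` {f}"
    unfolding R_classes_def by (elim quotientE) simp
  then have "d = dom_class X (dom f)" "dom f \<in> Pow X"
    using green_R_class_symmetric_inverse_monoid by (auto simp: partial_bijections_def)
  then show "d \<in> dom_class X ` Pow X" by (rule image_eqI)
next
  fix d assume "d \<in> dom_class X ` Pow X"
  then obtain A where A: "A \<subseteq> X" "d = dom_class X A" by blast
  \<comment> \<open>The partial identity represents the class of domain \<open>A\<close>.\<close>
  have id: "Some |` A \<in> partial_bijections X X" using A by (simp add: Some_restrict_partial_bijection)
  then have "green_R (symmetric_inverse_monoid X) `` {Some |` A} \<in> R_classes (symmetric_inverse_monoid X)"
    unfolding R_classes_def by (intro quotientI) simp
  then show "d \<in> R_classes (symmetric_inverse_monoid X)"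
    using green_R_class_symmetric_inverse_monoid[OF id] A by simp
qed

lemma R_le_dom_class:
  assumes "A \<subseteq> X" "B \<subseteq> X"
  shows "R_le (symmetric_inverse_monoid X) (dom_class X A) (dom_class X B) \<longleftrightarrow> A \<subseteq> B"
proof -
  have "principal_right_ideal (symmetric_inverse_monoid X) f \<subseteq>
      principal_right_ideal (symmetric_inverse_monoid X) g \<longleftrightarrow> A \<subseteq> B"
    if "f \<in> dom_class X A" "g \<in> dom_class X B" for f g
    using that principal_right_ideal_subset_iff[of f X g] by (simp add: dom_class_def)
  then show ?thesis
    using Some_restrict_dom_class[OF assms(1)] Some_restrict_dom_class[OF assms(2)]
    unfolding R_le_def by blast
qed

lemma idempotents_symmetric_inverse_monoid:
  "idempotents (symmetric_inverse_monoid X) = (\<lambda>A. Some |` A) ` Pow X"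
proof (intro equalityI subsetI)
  fix f assume "f \<in> idempotents (symmetric_inverse_monoid X)"
  then have f: "f \<in> partial_bijections X X" "f \<circ>\<^sub>m f = f" by (auto simp: idempotents_def)
  have "f x = (Some |` dom f) x" for x
  proof (cases "f x")
    case (Some y)
    \<comment> \<open>Idempotence makes \<open>y\<close>, the value at \<open>x\<close>, a fixed
      point; then \<open>x\<close> and \<open>y\<close> have the same value, and injectivity gives
      \<open>x = y\<close>.\<close>
    then have "f y = Some y" using fun_cong[OF f(2), of x]
      using f(1) by (simp add: map_comp_def)
    then have "x = y" using f(1) Some by (auto simp: partial_bijections_iff)
    then show ?thesis using Some by (simp add: restrict_map_def domI)
  qed (simp add: restrict_map_def dom_def)
  then show "f \<in> (\<lambda>A. Some |` A) ` Pow X" using f(1) by (auto simp: partial_bijections_def)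
next
  fix f :: "'a \<rightharpoonup> 'a" assume "f \<in> (\<lambda>A. Some |` A) ` Pow X"
  then show "f \<in> idempotents (symmetric_inverse_monoid X)"
    by (auto simp: idempotents_def Some_restrict_partial_bijection Some_restrict_comp)
qed

section \<open>Connecting idempotents and self-support of the category of subsets\<close>

text \<open>Carries classes, their order and idempotents from the monoid to the cones, and shows
  that the product of cones is closed.\<close>

interpretation cone_iso:
  semigroup_iso "symmetric_inverse_monoid X" "cone_semigroup (subset_category X)" "subset_cone X" for X
  by unfold_locales (simp_all add: subset_cone_iso partial_bijections_comp)

lemma idempotent_subset_cone_iff:
  "f \<in> partial_bijections X X \<Longrightarrow>
     subset_cone X f \<in> idempotents (cone_semigroup (subset_category X)) \<longleftrightarrow> f = Some |` dom f"
  using cone_iso.idempotent_iff[of f X]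
  by (auto simp: idempotents_symmetric_inverse_monoid partial_bijections_def image_iff)

lemma idempotent_cones_subset_category:
  "idempotents (cone_semigroup (subset_category X)) = (\<lambda>A. subset_cone X (Some |` A)) ` Pow X"
  by (simp add: cone_iso.idempotents_image idempotents_symmetric_inverse_monoid image_image)

text \<open>Among the partial bijections with domain \<open>A\<close>, the identity on
  \<open>A\<close> is the only idempotent, and the vertex of its cone is its image, again
  \<open>A\<close>.\<close>

lemma connected_by_subset_category:
  assumes "A \<subseteq> X"
  shows "connected_by (subset_category X) B (subset_cone X ` dom_class X A) \<longleftrightarrow> B = A"
proof -
  have "subset_cone X f \<in> idempotents (cone_semigroup (subset_category X)) \<and>
      vertex (subset_category X) (subset_cone X f) = B \<longleftrightarrow> f = Some |` A \<and> B = A"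
    if f: "f \<in> dom_class X A" for f
  proof -
    have "f \<in> partial_bijections X X" "dom f = A" using f by (auto simp: dom_class_def)
    then have "vertex (subset_category X) (subset_cone X f) = ran f"
      "subset_cone X f \<in> idempotents (cone_semigroup (subset_category X)) \<longleftrightarrow> f = Some |` A"
      by (simp_all add: vertex_subset_cone idempotent_subset_cone_iff)
    then show ?thesis using ran_Some_restrict[of A] by metis
  qed
  then show ?thesis
    using Some_restrict_dom_class[OF assms] by (auto simp: connected_by_def)
qed

lemma R_classes_cones_subset_category:
  "R_classes (cone_semigroup (subset_category X)) = (\<lambda>A. subset_cone X ` dom_class X A) ` Pow X"
  by (simp add: cone_iso.R_classes_image R_classes_symmetric_inverse_monoid image_image)

lemma self_supported_subset_category:
  "self_supported_category (subset_category X) (R_classes (cone_semigroup (subset_category X)))"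
proof -
  let ?D = "R_classes (cone_semigroup (subset_category X))"
  let ?d = "\<lambda>A. subset_cone X ` dom_class X A"
  have conn: "d \<in> ?D \<and> connected_by (subset_category X) A d \<longleftrightarrow> d = ?d A" if "A \<subseteq> X" for A d
    using that by (auto simp: R_classes_cones_subset_category connected_by_subset_category)
  then have support: "support_map (subset_category X) ?D A = ?d A" if "A \<subseteq> X" for A
    using that by (simp add: support_map_def)
  have "inj_on ?d (Pow X)"
  proof (rule inj_onI)
    fix A B assume A: "A \<in> Pow X" and B: "B \<in> Pow X" and eq: "?d A = ?d B"
    \<comment> \<open>A class connects a single object, so the class determines the set.\<close>
    have "connected_by (subset_category X) B (?d A)"
      unfolding eq using B by (simp add: connected_by_subset_category)
    then show "A = B" using A by (simp add: connected_by_subset_category)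
  qed
  then have "bij_betw ?d (Pow X) ?D" by (simp add: bij_betw_def R_classes_cones_subset_category)
  moreover have "bij_betw (support_map (subset_category X) ?D) (Pow X) ?D \<longleftrightarrow> bij_betw ?d (Pow X) ?D"
    by (rule bij_betw_cong) (simp add: support)
  moreover have "R_le (cone_semigroup (subset_category X)) (?d A) (?d B) \<longleftrightarrow> A \<subseteq> B"
    if "A \<subseteq> X" "B \<subseteq> X" for A B
    using that by (simp add: cone_iso.R_le_image_iff R_classes_symmetric_inverse_monoid R_le_dom_class)
  moreover have "\<exists>d \<in> ?D. connected_by (subset_category X) A d" if "A \<subseteq> X" for A
    using conn[OF that] by blast
  moreover have "\<exists>!d. d \<in> ?D \<and> connected_by (subset_category X) A d" if "A \<subseteq> X" for A
    using conn[OF that] by simp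
  ultimately show ?thesis
    by (auto simp: self_supported_category_def supported_category_def connected_category_def
        normal_category_subset_category down_set_R_classes subobject_subset_category support)
qed

section \<open>The category of principal left ideals\<close>

definition left_ideal_of_subset :: "'a set \<Rightarrow> 'a set \<Rightarrow> ('a \<rightharpoonup> 'a) set" where
  "left_ideal_of_subset X A = left_ideal (symmetric_inverse_monoid X) (Some |` A)"

text \<open>Recovers \<open>A\<close> from the left ideal generated by its partial identity: all
  members have image inside \<open>A\<close>, and the generator has image \<open>A\<close>.\<close>

definition subset_of_left_ideal :: "('a \<rightharpoonup> 'a) set \<Rightarrow> 'a set" where
  "subset_of_left_ideal L = (\<Union>f \<in> L. ran f)"

definition left_ideal_mor ::
  "'a set \<Rightarrow> 'a set \<times> ('a \<rightharpoonup> 'a) \<times> 'a set \<Rightarrow>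
   ('a \<rightharpoonup> 'a) set \<times> (('a \<rightharpoonup> 'a) \<Rightarrow> ('a \<rightharpoonup> 'a)) \<times> ('a \<rightharpoonup> 'a) set" where
  "left_ideal_mor X = (\<lambda>(A, f, B). r_map (symmetric_inverse_monoid X) (Some |` A) f (Some |` B))"

text \<open>A right translation by \<open>u\<close> in \<open>eSf\<close> is recovered by evaluating
  it at the generator \<open>e\<close>, since \<open>eu = u\<close>. Here \<open>e\<close> is the
  partial identity on the recovered subset.\<close>

definition subset_mor ::
  "('a \<rightharpoonup> 'a) set \<times> (('a \<rightharpoonup> 'a) \<Rightarrow> ('a \<rightharpoonup> 'a)) \<times> ('a \<rightharpoonup> 'a) set \<Rightarrow>
   'a set \<times> ('a \<rightharpoonup> 'a) \<times> 'a set" where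
  "subset_mor = (\<lambda>(L, \<phi>, L').
     (subset_of_left_ideal L, \<phi> (Some |` subset_of_left_ideal L), subset_of_left_ideal L'))"

lemma mem_left_ideal_of_subset:
  assumes "A \<subseteq> X"
  shows "f \<in> left_ideal_of_subset X A \<longleftrightarrow> f \<in> partial_bijections X A"
proof
  assume "f \<in> left_ideal_of_subset X A"
  then obtain g where "g \<in> partial_bijections X X" "f = (Some |` A) \<circ>\<^sub>m g"
    by (auto simp: left_ideal_of_subset_def left_ideal_def)
  then show "f \<in> partial_bijections X A"
    using partial_bijections_comp[OF _ Some_restrict_partial_bijection[OF assms subset_refl]] by simp
next
  assume f: "f \<in> partial_bijections X A"
  then have "f \<in> partial_bijections X X" "f = (Some |` A) \<circ>\<^sub>m f"
    using partial_bijections_mono[OF f subset_refl assms] by (simp_all add: partial_bijections_unit)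
  then show "f \<in> left_ideal_of_subset X A"
    unfolding left_ideal_of_subset_def left_ideal_def symmetric_inverse_monoid_simps by blast
qed

lemma Some_restrict_left_ideal: "A \<subseteq> X \<Longrightarrow> Some |` A \<in> left_ideal_of_subset X A"
  by (simp add: mem_left_ideal_of_subset Some_restrict_partial_bijection)

lemma subset_of_left_ideal_of_subset:
  assumes "A \<subseteq> X"
  shows "subset_of_left_ideal (left_ideal_of_subset X A) = A"
proof (intro equalityI subsetI)
  fix x assume "x \<in> subset_of_left_ideal (left_ideal_of_subset X A)"
  then show "x \<in> A"
    unfolding subset_of_left_ideal_def
    by (auto simp: mem_left_ideal_of_subset[OF assms] partial_bijections_def)
next
  fix x assume "x \<in> A"
  then have "x \<in> ran (Some |` A)" by simp
  then show "x \<in> subset_of_left_ideal (left_ideal_of_subset X A)"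
    unfolding subset_of_left_ideal_def using Some_restrict_left_ideal[OF assms] by blast
qed

lemma left_ideal_of_subset_mono_iff:
  assumes "A \<subseteq> X" "B \<subseteq> X"
  shows "left_ideal_of_subset X A \<subseteq> left_ideal_of_subset X B \<longleftrightarrow> A \<subseteq> B"
proof
  assume "left_ideal_of_subset X A \<subseteq> left_ideal_of_subset X B"
  then have "subset_of_left_ideal (left_ideal_of_subset X A) \<subseteq>
      subset_of_left_ideal (left_ideal_of_subset X B)"
    unfolding subset_of_left_ideal_def by blast
  then show "A \<subseteq> B" using assms by (simp add: subset_of_left_ideal_of_subset)
next
  assume "A \<subseteq> B"
  then show "left_ideal_of_subset X A \<subseteq> left_ideal_of_subset X B"
    using assms partial_bijections_mono[OF _ subset_refl]
    by (auto simp: mem_left_ideal_of_subset)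
qed

text \<open>Multiplying by the two partial identities cuts domain and image down to \<open>A\<close>
  and \<open>B\<close> and fixes whatever already fits. The left-hand side is kept in the form in
  which \<open>left_ideal_category\<close> presents \<open>eSf\<close>, so that arrows of the two
  categories can be matched literally.\<close>

lemma local_partial_bijections:
  assumes "A \<subseteq> X" "B \<subseteq> X"
  shows "{Some |` A \<otimes>\<^bsub>symmetric_inverse_monoid X\<^esub> s \<otimes>\<^bsub>symmetric_inverse_monoid X\<^esub> Some |` B | s.
    s \<in> carrier (symmetric_inverse_monoid X)} = partial_bijections A B"
proof (intro equalityI subsetI)
  fix f assume "f \<in> {Some |` A \<otimes>\<^bsub>symmetric_inverse_monoid X\<^esub> s \<otimes>\<^bsub>symmetric_inverse_monoid X\<^esub> Some |` B | s.
    s \<in> carrier (symmetric_inverse_monoid X)}"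
  then obtain s where "s \<in> partial_bijections X X" "f = (Some |` B) \<circ>\<^sub>m (s \<circ>\<^sub>m (Some |` A))"
    by auto
  then show "f \<in> partial_bijections A B"
    using Some_restrict_partial_bijection[OF subset_refl assms(1)]
      Some_restrict_partial_bijection[OF assms(2) subset_refl]
    by (auto intro: partial_bijections_comp)
next
  fix f assume f: "f \<in> partial_bijections A B"
  have "f \<in> partial_bijections X X" using partial_bijections_mono[OF f assms] .
  moreover have "f = (Some |` B) \<circ>\<^sub>m (f \<circ>\<^sub>m (Some |` A))"
    using f by (simp add: map_comp_Some_restrict partial_bijections_unit)
  ultimately show "f \<in> {Some |` A \<otimes>\<^bsub>symmetric_inverse_monoid X\<^esub> s \<otimes>\<^bsub>symmetric_inverse_monoid X\<^esub> Some |` B | s.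
    s \<in> carrier (symmetric_inverse_monoid X)}"
    unfolding symmetric_inverse_monoid_simps by blast
qed

section \<open>The category of left ideals as an isomorphic copy of the category of subsets\<close>

lemma left_ideal_mor_eq:
  "left_ideal_mor X (A, f, B) =
    (left_ideal_of_subset X A, (\<lambda>g \<in> left_ideal_of_subset X A. f \<circ>\<^sub>m g), left_ideal_of_subset X B)"
  by (simp add: left_ideal_mor_def r_map_def left_ideal_of_subset_def)

lemma Obj_left_ideal_category:
  "Obj (left_ideal_category (symmetric_inverse_monoid X)) = left_ideal_of_subset X ` Pow X"
  unfolding left_ideal_category_def left_ideal_of_subset_def idempotents_symmetric_inverse_monoid
  by auto

lemma Arr_left_ideal_category:
  "Arr (left_ideal_category (symmetric_inverse_monoid X)) = left_ideal_mor X ` Arr (subset_category X)"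
proof (intro equalityI subsetI)
  fix F assume "F \<in> Arr (left_ideal_category (symmetric_inverse_monoid X))"
  then obtain A B f where *: "A \<subseteq> X" "B \<subseteq> X" "F = r_map (symmetric_inverse_monoid X) (Some |` A) f (Some |` B)"
    "f \<in> {Some |` A \<otimes>\<^bsub>symmetric_inverse_monoid X\<^esub> s \<otimes>\<^bsub>symmetric_inverse_monoid X\<^esub> Some |` B | s.
      s \<in> carrier (symmetric_inverse_monoid X)}"
    unfolding left_ideal_category_def idempotents_symmetric_inverse_monoid
    by (auto simp del: symmetric_inverse_monoid_simps)
  then have "f \<in> partial_bijections A B" by (simp only: local_partial_bijections)
  then have "(A, f, B) \<in> Arr (subset_category X)" using * by simp
  moreover have "F = left_ideal_mor X (A, f, B)" using * by (simp add: left_ideal_mor_def)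
  ultimately show "F \<in> left_ideal_mor X ` Arr (subset_category X)" by blast
next
  fix F assume "F \<in> left_ideal_mor X ` Arr (subset_category X)"
  then obtain A f B where *: "A \<subseteq> X" "B \<subseteq> X" "f \<in> partial_bijections A B" "F = left_ideal_mor X (A, f, B)"
    by auto
  then have "f \<in> {Some |` A \<otimes>\<^bsub>symmetric_inverse_monoid X\<^esub> s \<otimes>\<^bsub>symmetric_inverse_monoid X\<^esub> Some |` B | s.
      s \<in> carrier (symmetric_inverse_monoid X)}"
    by (simp only: local_partial_bijections)
  moreover have "Some |` A \<in> idempotents (symmetric_inverse_monoid X)"
    "Some |` B \<in> idempotents (symmetric_inverse_monoid X)"
    using * by (auto simp: idempotents_symmetric_inverse_monoid)
  moreover have "F = r_map (symmetric_inverse_monoid X) (Some |` A) f (Some |` B)"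
    using * by (simp add: left_ideal_mor_def)
  ultimately show "F \<in> Arr (left_ideal_category (symmetric_inverse_monoid X))"
    unfolding left_ideal_category_def by (simp del: symmetric_inverse_monoid_simps) blast
qed

lemma Incl_left_ideal_category:
  "Incl (left_ideal_category (symmetric_inverse_monoid X)) = left_ideal_mor X ` Incl (subset_category X)"
proof (intro equalityI subsetI)
  fix F assume "F \<in> Incl (left_ideal_category (symmetric_inverse_monoid X))"
  then obtain A B where *: "A \<subseteq> X" "B \<subseteq> X"
    "F = r_map (symmetric_inverse_monoid X) (Some |` A) (Some |` A) (Some |` B)"
    "left_ideal_of_subset X A \<subseteq> left_ideal_of_subset X B"
    unfolding left_ideal_category_def idempotents_symmetric_inverse_monoid left_ideal_of_subset_def
    by auto
  then have "(A, Some |` A, B) \<in> Incl (subset_category X)"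
    by (simp add: left_ideal_of_subset_mono_iff)
  moreover have "F = left_ideal_mor X (A, Some |` A, B)" using * by (simp add: left_ideal_mor_def)
  ultimately show "F \<in> left_ideal_mor X ` Incl (subset_category X)" by blast
next
  fix F assume "F \<in> left_ideal_mor X ` Incl (subset_category X)"
  then obtain A B where *: "A \<subseteq> B" "B \<subseteq> X" "F = left_ideal_mor X (A, Some |` A, B)"
    by auto
  then have "left_ideal_of_subset X A \<subseteq> left_ideal_of_subset X B"
    using left_ideal_of_subset_mono_iff[of A X B] by simp
  moreover have "Some |` A \<in> idempotents (symmetric_inverse_monoid X)"
    "Some |` B \<in> idempotents (symmetric_inverse_monoid X)"
    using * by (auto simp: idempotents_symmetric_inverse_monoid)
  moreover have "F = r_map (symmetric_inverse_monoid X) (Some |` A) (Some |` A) (Some |` B)"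
    using * by (simp add: left_ideal_mor_def)
  ultimately show "F \<in> Incl (left_ideal_category (symmetric_inverse_monoid X))"
    unfolding left_ideal_category_def left_ideal_of_subset_def by simp blast
qed

text \<open>The translation by \<open>f\<close>, evaluated at the partial identity on
  \<open>A\<close>, gives the restriction of \<open>f\<close> to \<open>A\<close>, which is
  \<open>f\<close>. In particular \<open>left_ideal_mor X\<close> is injective on arrows.\<close>

lemma subset_mor_left_ideal_mor:
  assumes "F \<in> Arr (subset_category X)"
  shows "subset_mor (left_ideal_mor X F) = F"
proof -
  obtain A f B where "F = (A, f, B)" "A \<subseteq> X" "B \<subseteq> X" "f \<in> partial_bijections A B"
    using assms by auto
  then show ?thesis
    by (simp add: left_ideal_mor_eq subset_mor_def subset_of_left_ideal_of_subset
        Some_restrict_left_ideal map_comp_Some_restrict partial_bijections_unit)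
qed

lemma left_ideal_category_simps:
  "Dom (left_ideal_category S) (L, \<phi>, L') = L"
  "Cod (left_ideal_category S) (L, \<phi>, L') = L'"
  "Ide (left_ideal_category S) L = (L, \<lambda>x \<in> L. x, L)"
  "(L, \<phi>, L') \<cdot>\<^bsub>left_ideal_category S\<^esub> (L'', \<psi>, M) = (L, compose L \<psi> \<phi>, M)"
  by (simp_all add: left_ideal_category_def)

lemma left_ideal_mor_Comp:
  assumes "A \<subseteq> X" "B \<subseteq> X" "f \<in> partial_bijections A B"
  shows "left_ideal_mor X ((A, f, B) \<cdot>\<^bsub>subset_category X\<^esub> (B, g, D)) =
    left_ideal_mor X (A, f, B) \<cdot>\<^bsub>left_ideal_category (symmetric_inverse_monoid X)\<^esub> left_ideal_mor X (B, g, D)"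
proof -
  \<comment> \<open>Values of the first translation stay in the left ideal of \<open>B\<close>,
    where the second one is a genuine product rather than \<open>undefined\<close>.\<close>
  have "f \<circ>\<^sub>m h \<in> left_ideal_of_subset X B" if "h \<in> left_ideal_of_subset X A" for h
    using that partial_bijections_comp[OF _ assms(3)] assms(1,2) by (simp add: mem_left_ideal_of_subset)
  then show ?thesis
    by (auto simp: left_ideal_mor_eq left_ideal_category_simps compose_def map_comp_assoc)
qed

lemma subset_left_ideal_category_iso:
  "category_iso (subset_category X) (left_ideal_category (symmetric_inverse_monoid X))
    (left_ideal_of_subset X) (left_ideal_mor X) subset_of_left_ideal subset_mor"
proof (intro category_iso.intro category_iso_axioms.intro category_subset_category)
  let ?L = "left_ideal_category (symmetric_inverse_monoid X)"
  show "left_ideal_mor X (Ide (subset_category X) A) = Ide ?L (left_ideal_of_subset X A)"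
    if A: "A \<in> Obj (subset_category X)" for A
  proof -
    have "(Some |` A) \<circ>\<^sub>m h = h" if "h \<in> left_ideal_of_subset X A" for h
      using that A by (simp add: mem_left_ideal_of_subset partial_bijections_unit)
    then show ?thesis by (auto simp: left_ideal_mor_eq left_ideal_category_simps)
  qed
  show "left_ideal_mor X (F \<cdot>\<^bsub>subset_category X\<^esub> G) = left_ideal_mor X F \<cdot>\<^bsub>?L\<^esub> left_ideal_mor X G"
    if F: "F \<in> Arr (subset_category X)" and G: "G \<in> Arr (subset_category X)"
      and FG: "Cod (subset_category X) F = Dom (subset_category X) G" for F G
  proof -
    obtain A f B where 1: "F = (A, f, B)" "A \<subseteq> X" "B \<subseteq> X" "f \<in> partial_bijections A B"
      using F by auto
    obtain B' g D where 2: "G = (B', g, D)" using G by auto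
    then have "B' = B" using FG 1 by simp
    then show ?thesis using left_ideal_mor_Comp[OF 1(2-4)] 1(1) 2 by blast
  qed
  show "Dom ?L (left_ideal_mor X F) = left_ideal_of_subset X (Dom (subset_category X) F)"
    "Cod ?L (left_ideal_mor X F) = left_ideal_of_subset X (Cod (subset_category X) F)"
    if F: "F \<in> Arr (subset_category X)" for F
    by (cases F; simp add: left_ideal_mor_eq left_ideal_category_simps)+
  show "subset_mor F' \<in> Arr (subset_category X)" "left_ideal_mor X (subset_mor F') = F'"
    if F': "F' \<in> Arr ?L" for F'
  proof -
    obtain F where "F \<in> Arr (subset_category X)" "F' = left_ideal_mor X F"
      using F' unfolding Arr_left_ideal_category by blast
    then show "subset_mor F' \<in> Arr (subset_category X)" "left_ideal_mor X (subset_mor F') = F'"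
      using subset_mor_left_ideal_mor by metis+
  qed
  show "left_ideal_mor X F \<in> Arr ?L" if "F \<in> Arr (subset_category X)" for F
    unfolding Arr_left_ideal_category using that by (rule imageI)
qed (auto simp: Obj_left_ideal_category subset_of_left_ideal_of_subset subset_mor_left_ideal_mor
    simp del: subset_category_simps(2))

lemma subset_left_ideal_cone_semigroup_iso:
  "cone_semigroup_iso (subset_category X) (left_ideal_category (symmetric_inverse_monoid X))
    (left_ideal_of_subset X) (left_ideal_mor X) subset_of_left_ideal subset_mor"
proof (intro cone_semigroup_iso.intro cone_semigroup_iso_axioms.intro normal_category_iso.intro
    normal_category_subset_category subobject_category_iso.intro subobject_category_iso_axioms.intro
    category_with_subobjects_subset_category subset_left_ideal_category_iso)
  let ?C = "subset_category X" and ?L = "left_ideal_category (symmetric_inverse_monoid X)"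
  have Incl: "Incl ?C \<subseteq> Arr ?C"
    by (rule category_with_subobjects.Incl_subset[OF category_with_subobjects_subset_category])
  then show "Incl ?L \<subseteq> Arr ?L"
    unfolding Incl_left_ideal_category Arr_left_ideal_category by (rule image_mono)
  show "left_ideal_mor X F \<in> Incl ?L \<longleftrightarrow> F \<in> Incl ?C" if F: "F \<in> Arr ?C" for F
  proof
    assume "left_ideal_mor X F \<in> Incl ?L"
    then obtain G where G: "G \<in> Incl ?C" "left_ideal_mor X F = left_ideal_mor X G"
      unfolding Incl_left_ideal_category by blast
    \<comment> \<open>Injectivity on arrows gives reflection of inclusions.\<close>
    have "F = G"
      using subset_mor_left_ideal_mor[OF F] subset_mor_left_ideal_mor[OF subsetD[OF Incl G(1)]]
      unfolding G(2) by (rule trans[OF sym])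
    then show "F \<in> Incl ?C" using G(1) by (rule ssubst)
  qed (simp only: Incl_left_ideal_category image_eqI)
  show "\<gamma> \<otimes>\<^bsub>cone_semigroup ?C\<^esub> \<delta> \<in> cones ?C" if "\<gamma> \<in> cones ?C" "\<delta> \<in> cones ?C" for \<gamma> \<delta>
    using cone_iso.target_mult_closed[of \<gamma> X \<delta>] that by (simp add: carrier_cone_semigroup)
  \<comment> \<open>On idempotent cones the vertex has the explicit left inverse sending
    \<open>A\<close> to the cone of its partial identity.\<close>
  have "vertex ?C (subset_cone X (Some |` A)) = A" if "A \<in> Pow X" for A
    using that by (simp add: vertex_subset_cone Some_restrict_partial_bijection)
  then show "inj_on (vertex ?C) (idempotents (cone_semigroup ?C))"
    unfolding idempotent_cones_subset_category
    by (intro inj_on_inverseI[where g = "\<lambda>A. subset_cone X (Some |` A)"]) auto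
qed

theorem theorem7p14:
  fixes X :: "'a set"
  shows "normal_category (subset_category X) \<and> bounded_above (subset_category X) \<and>
    cone_semigroup (subset_category X) \<cong> symmetric_inverse_monoid X \<and>
    isomorphic_self_supported
      (left_ideal_category (symmetric_inverse_monoid X))
      (R_classes (cone_semigroup (left_ideal_category (symmetric_inverse_monoid X))))
      (subset_category X)
      (R_classes (cone_semigroup (subset_category X)))"
proof (intro conjI)
  show "cone_semigroup (subset_category X) \<cong> symmetric_inverse_monoid X"
    unfolding is_iso_def using cone_iso.inv_into_iso by blast
  show "isomorphic_self_supported
      (left_ideal_category (symmetric_inverse_monoid X))
      (R_classes (cone_semigroup (left_ideal_category (symmetric_inverse_monoid X))))
      (subset_category X)
      (R_classes (cone_semigroup (subset_category X)))"
    \<comment> \<open>Transport started from the subsets, whose self-support was checked directly;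
      symmetry puts the left ideals first.\<close>
    by (rule isomorphic_self_supported_sym[OF
          cone_semigroup_iso.isomorphic_self_supported_target[OF
            subset_left_ideal_cone_semigroup_iso self_supported_subset_category]])
qed (rule normal_category_subset_category bounded_above_subset_category)+

end
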